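(* Let $d\ge1$, $r,s>0$, $\alpha,\lambda>0$, and let $P=f\cdot\lambda_d$ be the probability distribution on $\mathbb{R}^d$ with density $f(x)=c\,e^{-\lambda|x|^\alpha}$, where $c>0$ is the normalizing constant. Let $(\Gamma^n)_{n\ge1}$ be an asymptotically $L^r$-optimal sequence of quantizers of $P$. Set $$\theta^*=\Big(\frac{d+s}{d+r}\Big)^{\frac1\alpha}.$$ Then the sequence $\Gamma^n_{\theta^*,0}=\{\theta^*x:x\in\Gamma^n\}$ satisfies the $L^s$-empirical measure theorem, i.e. for every $a,b\in\mathbb{R}^d$, $$\frac1n\operatorname{card}\big(\Gamma^n_{\theta^*,0}\cap[a,b]\big)\xrightarrow[n\to+\infty]{}\frac{1}{C_{f,s}}\int_{[a,b]}f^{\frac{d}{d+s}}\,d\lambda_d,\qquad C_{f,s}=\int_{\mathbb{R}^d}f^{\frac{d}{d+s}}\,d\lambda_d .$$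
   Context: $|\cdot|$ is a fixed norm on $\mathbb{R}^d$ and $\lambda_d$ is Lebesgue measure on $\mathbb{R}^d$. For $a,b\in\mathbb{R}^d$, $[a,b]=\prod_{i=1}^d[a_i,b_i]$. For a finite set $\Gamma\subset\mathbb{R}^d$, $e_r(\Gamma,P)=\big(\int\min_{x\in\Gamma}|\xi-x|^r\,dP(\xi)\big)^{1/r}$, and $e_{r,n}(P)=\inf\{e_r(\Gamma,P):\operatorname{card}(\Gamma)\le n\}$. A sequence $(\Gamma^n)_{n\ge1}$ with $\operatorname{card}(\Gamma^n)\le n$ is asymptotically $L^r$-optimal for $P=f\cdot\lambda_d$ if $\lim_n n^{1/d}e_r(\Gamma^n,P)=Q_r(P)$, where $Q_r(P)=\lim_n n^{1/d}e_{r,n}(P)=\widetilde J_{r,d}\big(\int f^{\frac{d}{d+r}}d\lambda_d\big)^{\frac{d+r}{dr}}$ and $\widetilde J_{r,d}=\inf_{n\ge1}n^{1/d}e_{r,n}(U([0,1]^d))\in(0,\infty)$, $U([0,1]^d)$ being the uniform distribution on $[0,1]^d$ (Zador's theorem). *)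

theory Defs
  imports "HOL-Probability.Probability"
begin

text \<open>
  The space is \<open>real ^ 'd\<close>, so the dimension is \<open>CARD('d)\<close>. The norm is an arbitrary one,
  \<open>N\<close>, unrelated to the Euclidean \<open>norm\<close> of the type class.
\<close>

definition is_norm :: "(real ^ 'd \<Rightarrow> real) \<Rightarrow> bool" where
  "is_norm N \<longleftrightarrow>
     (\<forall>x. 0 \<le> N x) \<and>
     (\<forall>x. N x = 0 \<longleftrightarrow> x = 0) \<and>
     (\<forall>t x. N (t *\<^sub>R x) = \<bar>t\<bar> * N x) \<and>
     (\<forall>x y. N (x + y) \<le> N x + N y)"

text \<open>
  Meaningful for finite nonempty \<open>\<Gamma>\<close> and for \<open>P\<close> with a finite moment of order \<open>r\<close>
  (otherwise the Bochner integral is \<open>0\<close> by convention).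
\<close>

definition quant_error ::
  "(real ^ 'd \<Rightarrow> real) \<Rightarrow> real \<Rightarrow> (real ^ 'd) set \<Rightarrow> (real ^ 'd) measure \<Rightarrow> real" where
  "quant_error N r \<Gamma> P = (\<integral>\<xi>. Min ((\<lambda>x. N (\<xi> - x) powr r) ` \<Gamma>) \<partial>P) powr (1 / r)"

text \<open>
  The empty set is excluded: its error is \<open>\<infinity>\<close>, which does not affect the infimum, whereas
  \<open>Min {}\<close> is an unspecified real.
\<close>

definition opt_quant_error ::
  "(real ^ 'd \<Rightarrow> real) \<Rightarrow> real \<Rightarrow> nat \<Rightarrow> (real ^ 'd) measure \<Rightarrow> real" where
  "opt_quant_error N r n P =
     Inf {quant_error N r \<Gamma> P | \<Gamma>. finite \<Gamma> \<and> \<Gamma> \<noteq> {} \<and> card \<Gamma> \<le> n}"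

definition zador_const :: "(real ^ 'd \<Rightarrow> real) \<Rightarrow> real \<Rightarrow> real" where
  "zador_const N r =
     (INF n \<in> {1::nat..}.
        real n powr (1 / real CARD('d)) *
        opt_quant_error N r n (uniform_measure lborel (cbox 0 1 :: (real ^ 'd) set)))"

text \<open>
  The coefficient \<open>Q\<^sub>r(P)\<close> of \<open>P = density lborel f\<close>, given by the closed form in Zador's theorem.
\<close>

definition quant_coeff :: "(real ^ 'd \<Rightarrow> real) \<Rightarrow> real \<Rightarrow> (real ^ 'd \<Rightarrow> real) \<Rightarrow> real" where
  "quant_coeff N r f =
     zador_const N r *
     (\<integral>x. f x powr (real CARD('d) / (real CARD('d) + r)) \<partial>lborel)
       powr ((real CARD('d) + r) / (real CARD('d) * r))"

text \<open>The value \<open>\<Gamma> 0\<close> is irrelevant, sequences being indexed by \<open>n \<ge> 1\<close>.\<close>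

definition asymp_optimal ::
  "(real ^ 'd \<Rightarrow> real) \<Rightarrow> real \<Rightarrow> (real ^ 'd \<Rightarrow> real) \<Rightarrow> (nat \<Rightarrow> (real ^ 'd) set) \<Rightarrow> bool" where
  "asymp_optimal N r f \<Gamma> \<longleftrightarrow>
     (\<forall>n\<ge>1. finite (\<Gamma> n) \<and> \<Gamma> n \<noteq> {} \<and> card (\<Gamma> n) \<le> n) \<and>
     (\<lambda>n. real n powr (1 / real CARD('d)) *
           quant_error N r (\<Gamma> n) (density lborel (\<lambda>x. ennreal (f x))))
       \<longlonglongrightarrow> quant_coeff N r f"

definition satisfies_empirical_measure_thm ::
  "real \<Rightarrow> (real ^ 'd \<Rightarrow> real) \<Rightarrow> (nat \<Rightarrow> (real ^ 'd) set) \<Rightarrow> bool" where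
  "satisfies_empirical_measure_thm s f \<Gamma> \<longleftrightarrow>
     (\<forall>a b. (\<lambda>n. 1 / real n * real (card (\<Gamma> n \<inter> cbox a b)))
        \<longlonglongrightarrow> 1 / (\<integral>x. f x powr (real CARD('d) / (real CARD('d) + s)) \<partial>lborel) *
            (LINT x:cbox a b|lborel. f x powr (real CARD('d) / (real CARD('d) + s))))"

end

theory Submission
  imports Defs
begin

text \<open>
  The density \<open>f powr (d / (d + s))\<close> is, up to a factor, \<open>f powr (d / (d + r))\<close> dilated by \<open>\<theta>\<close>, so
  it is enough that asymptotically \<open>L\<^sup>r\<close>-optimal quantizers satisfy the empirical measure theorem
  of order \<open>r\<close>.

  Let \<open>J\<close> be Zador's constant, \<open>a = r / d\<close>, \<open>g = f powr (d / (d + r))\<close> and \<open>I = \<integral> g\<close>. Since \<open>J\<close> is an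
  infimum over all \<open>n\<close>, a cube \<open>Q\<close> containing \<open>v n\<close> of the \<open>n\<close> points contributes at least about
  \<open>J\<^sup>r (g |Q|) powr (1 + a) * v powr (- a)\<close> to \<open>n powr a\<close> times the error integral: the points become
  dense in compact sets, so those outside \<open>Q\<close> do not matter for a slightly smaller cube. The tangent
  to the convex function \<open>v powr (- a)\<close> makes this bound affine in \<open>v\<close>, hence additive over the small
  cubes filling an open set. By optimality the total error is asymptotically \<open>J\<^sup>r I powr (1 + a)\<close>,
  the minimum allowed by Hoelder's inequality, and comparing a box with its complement leaves
  \<open>(\<integral> g over the box) / I\<close> as the only possible limit of the proportion of points in the box.
\<close>

section \<open>Norms and distances to finite sets\<close>

lemma is_normD:
  assumes "is_norm N"
  shows is_norm_nonneg: "0 \<le> N x"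
    and is_norm_zero_iff: "N x = 0 \<longleftrightarrow> x = 0"
    and is_norm_scale: "N (t *\<^sub>R x) = \<bar>t\<bar> * N x"
    and is_norm_triangle: "N (x + y) \<le> N x + N y"
  using assms by (auto simp: is_norm_def)

lemma is_norm_triangle_sub:
  assumes "is_norm N"
  shows "N x \<le> N (x - y) + N y"
  using is_norm_triangle[OF assms, of "x - y" y] by simp

text \<open>Expansion in the standard basis: every coordinate of \<open>x\<close> is at most
  \<open>norm x\<close>, so the sum \<open>S\<close> of \<open>N\<close> over the basis vectors is
  an admissible factor. Adding 1 makes the constant visibly positive.\<close>

lemma is_norm_upper_bound:
  fixes N :: "real ^ 'd \<Rightarrow> real"
  assumes N: "is_norm N"
  obtains C where "C > 0" "\<And>x. N x \<le> C * norm x"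
proof
  define S where "S = (\<Sum>b\<in>Basis. N (b :: real ^ 'd))"
  have S: "S \<ge> 0"
    unfolding S_def by (intro sum_nonneg is_norm_nonneg[OF N])
  show "S + 1 > 0"
    using S by simp
  have sum_le: "N (\<Sum>b\<in>B. h b) \<le> (\<Sum>b\<in>B. N (h b))" if "finite B"
    for B :: "(real ^ 'd) set" and h :: "real ^ 'd \<Rightarrow> real ^ 'd"
    using that
  proof (induction B rule: finite_induct)
    case empty
    then show ?case using is_norm_zero_iff[OF N, of 0] by simp
  next
    case (insert b B)
    then show ?case using is_norm_triangle[OF N, of "h b" "\<Sum>b\<in>B. h b"] by simp
  qed
  show "N x \<le> (S + 1) * norm x" for x
  proof -
    have "N x = N (\<Sum>b\<in>Basis. (x \<bullet> b) *\<^sub>R b)"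
      by (simp add: euclidean_representation)
    also have "\<dots> \<le> (\<Sum>b\<in>Basis. N ((x \<bullet> b) *\<^sub>R b))"
      by (rule sum_le) simp
    also have "\<dots> \<le> (\<Sum>b\<in>Basis. norm x * N b)"
      unfolding is_norm_scale[OF N]
      by (intro sum_mono mult_right_mono Basis_le_norm is_norm_nonneg[OF N])
    also have "\<dots> = S * norm x"
      by (simp add: S_def sum_distrib_left mult.commute)
    also have "\<dots> \<le> (S + 1) * norm x"
      by (intro mult_right_mono) auto
    finally show ?thesis .
  qed
qed

lemma is_norm_continuous:
  fixes N :: "real ^ 'd \<Rightarrow> real"
  assumes N: "is_norm N"
  shows "continuous_on A N"
proof -
  obtain C where C: "C > 0" "\<And>x. N x \<le> C * norm x"
    using is_norm_upper_bound[OF N] by blast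
  have "\<bar>N x - N y\<bar> \<le> C * norm (x - y)" for x y
    using is_norm_triangle_sub[OF N, of x y] is_norm_triangle_sub[OF N, of y x]
      C(2)[of "x - y"] C(2)[of "y - x"] by (simp add: norm_minus_commute)
  then have "C-lipschitz_on A N"
    using C(1) by (auto simp: lipschitz_on_def dist_norm)
  then show ?thesis
    by (rule lipschitz_on_continuous_on)
qed

text \<open>Compactness: \<open>N\<close> attains a positive minimum on the Euclidean unit sphere,
  and homogeneity carries it to all vectors.\<close>

lemma is_norm_lower_bound:
  fixes N :: "real ^ 'd \<Rightarrow> real"
  assumes N: "is_norm N"
  obtains c where "c > 0" "\<And>x. c * norm x \<le> N x"
proof -
  have ne: "sphere 0 1 \<noteq> ({} :: (real ^ 'd) set)"
    using vector_choose_size[of 1] by (auto simp: sphere_def) 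
  obtain e :: "real ^ 'd" where e: "norm e = 1" "\<And>y. norm y = 1 \<Longrightarrow> N e \<le> N y"
    using continuous_attains_inf[OF compact_sphere ne is_norm_continuous[OF N]] by auto
  show thesis
  proof
    have "e \<noteq> 0"
      using e(1) by auto
    then show "N e > 0"
      using is_norm_nonneg[OF N, of e] is_norm_zero_iff[OF N, of e] by simp
    show "N e * norm x \<le> N x" for x
    proof (cases "x = 0")
      case False
      have "N e \<le> N ((1 / norm x) *\<^sub>R x)"
        using False by (intro e(2)) simp
      then show ?thesis
        using False by (simp add: is_norm_scale[OF N] field_simps)
    qed (simp add: is_norm_nonneg[OF N])
  qed
qed

text \<open>The integrand of \<open>quant_error\<close>. Without the outer power
  \<open>1 / r\<close>, error integrals add up over disjoint sets.\<close>

definition min_dist_powr ::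
  "(real ^ 'd \<Rightarrow> real) \<Rightarrow> real \<Rightarrow> (real ^ 'd) set \<Rightarrow> real ^ 'd \<Rightarrow> real" where
  "min_dist_powr N r \<Gamma> \<xi> = Min ((\<lambda>x. N (\<xi> - x) powr r) ` \<Gamma>)"

lemma quant_error_eq_min_dist_powr:
  "quant_error N r \<Gamma> P = (\<integral>\<xi>. min_dist_powr N r \<Gamma> \<xi> \<partial>P) powr (1 / r)"
  by (simp add: quant_error_def min_dist_powr_def)

lemma min_dist_powr_attained:
  assumes "finite \<Gamma>" "\<Gamma> \<noteq> {}"
  obtains x where "x \<in> \<Gamma>" "min_dist_powr N r \<Gamma> \<xi> = N (\<xi> - x) powr r"
proof -
  have "min_dist_powr N r \<Gamma> \<xi> \<in> (\<lambda>x. N (\<xi> - x) powr r) ` \<Gamma>"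
    unfolding min_dist_powr_def using assms by (intro Min_in) auto
  then show thesis
    using that by auto
qed

lemma min_dist_powr_le:
  assumes "finite \<Gamma>" "x \<in> \<Gamma>"
  shows "min_dist_powr N r \<Gamma> \<xi> \<le> N (\<xi> - x) powr r"
  unfolding min_dist_powr_def using assms by (intro Min_le) auto

lemma min_dist_powr_ge:
  assumes "finite \<Gamma>" "\<Gamma> \<noteq> {}" "\<And>x. x \<in> \<Gamma> \<Longrightarrow> v \<le> N (\<xi> - x) powr r"
  shows "v \<le> min_dist_powr N r \<Gamma> \<xi>"
  using min_dist_powr_attained[OF assms(1,2)] assms(3) by metis

lemma min_dist_powr_nonneg:
  assumes "finite \<Gamma>" "\<Gamma> \<noteq> {}"
  shows "0 \<le> min_dist_powr N r \<Gamma> \<xi>"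
  using min_dist_powr_ge[OF assms] by simp

lemma continuous_on_min_dist_powr:
  fixes N :: "real ^ 'd \<Rightarrow> real"
  assumes N: "is_norm N" and "r > 0" and "finite \<Gamma>" "\<Gamma> \<noteq> {}"
  shows "continuous_on A (min_dist_powr N r \<Gamma>)"
  using assms(3,4)
proof (induction \<Gamma> rule: finite_ne_induct)
  have cont: "continuous_on A (\<lambda>\<xi>. N (\<xi> - x) powr r)" for x
    using \<open>r > 0\<close> is_norm_nonneg[OF N]
    by (intro continuous_on_powr' continuous_on_compose2[OF is_norm_continuous[OF N, of UNIV]]
        continuous_intros) auto
  {
    case (singleton x)
    then show ?case using cont by (simp add: min_dist_powr_def[abs_def])
  next
    case (insert x \<Gamma>)
    then show ?case using cont by (simp add: min_dist_powr_def[abs_def] continuous_on_min)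
  }
qed

lemma borel_measurable_min_dist_powr:
  fixes N :: "real ^ 'd \<Rightarrow> real"
  assumes "is_norm N" "r > 0" "finite \<Gamma>" "\<Gamma> \<noteq> {}"
  shows "min_dist_powr N r \<Gamma> \<in> borel_measurable borel"
  using continuous_on_min_dist_powr[OF assms] by (rule borel_measurable_continuous_onI)

section \<open>Affine substitution in Lebesgue integrals\<close>

lemma
  fixes h :: "'a :: euclidean_space \<Rightarrow> real"
  assumes [measurable]: "h \<in> borel_measurable borel" and "c \<noteq> 0"
  shows lborel_integral_affine: "(\<integral>x. h x \<partial>lborel) = \<bar>c\<bar> ^ DIM('a) * (\<integral>x. h (t + c *\<^sub>R x) \<partial>lborel)"
    and lborel_integrable_affine_iff: "integrable lborel (\<lambda>x. h (t + c *\<^sub>R x)) \<longleftrightarrow> integrable lborel h"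
proof -
  have eq: "lborel = density (distr lborel borel (\<lambda>x :: 'a. t + c *\<^sub>R x)) (\<lambda>_. ennreal (\<bar>c\<bar> ^ DIM('a)))"
    using lborel_affine[OF \<open>c \<noteq> 0\<close>, of t] by simp
  show "(\<integral>x. h x \<partial>lborel) = \<bar>c\<bar> ^ DIM('a) * (\<integral>x. h (t + c *\<^sub>R x) \<partial>lborel)"
    by (subst eq, subst integral_density) (auto simp: integral_distr)
  show "integrable lborel (\<lambda>x. h (t + c *\<^sub>R x)) \<longleftrightarrow> integrable lborel h"
    using \<open>c \<noteq> 0\<close>
    by (subst (2) eq, subst integrable_density) (auto simp: integrable_distr_eq)
qed

section \<open>Zador's constant and quantization of cubes\<close>

lemma set_integral_mono_set:
  fixes h :: "'a \<Rightarrow> real"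
  assumes "set_integrable M B h" "A \<in> sets M" "A \<subseteq> B" "\<And>x. x \<in> B \<Longrightarrow> 0 \<le> h x"
  shows "(LINT x:A|M. h x) \<le> (LINT x:B|M. h x)"
  using assms set_integrable_subset[OF assms(1-3)]
  unfolding set_lebesgue_integral_def set_integrable_def
  by (intro integral_mono) (auto simp: indicator_def)

lemma content_cube:
  fixes u :: "real ^ 'd"
  assumes "l \<ge> 0"
  shows "measure lborel (cbox u (u + l *\<^sub>R 1)) = l ^ CARD('d)"
proof -
  have "cbox u (u + l *\<^sub>R 1) \<noteq> {}"
    using assms by (auto simp: interval_ne_empty_cart)
  then show ?thesis
    by (simp add: content_cbox_cart)
qed

lemma set_integrable_continuous_compact:
  fixes h :: "'a :: euclidean_space \<Rightarrow> real"
  assumes "compact K" "continuous_on K h"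
  shows "set_integrable lborel K h"
  unfolding set_integrable_def using borel_integrable_compact[OF assms] by simp

lemma set_integrable_min_dist_powr_cbox:
  fixes N :: "real ^ 'd \<Rightarrow> real"
  assumes "is_norm N" "r > 0" "finite \<Gamma>" "\<Gamma> \<noteq> {}"
  shows "set_integrable lborel (cbox a b) (min_dist_powr N r \<Gamma>)"
  using compact_cbox continuous_on_min_dist_powr[OF assms]
  by (rule set_integrable_continuous_compact)

lemma integral_uniform_measure_unit_cube:
  fixes h :: "real ^ 'd \<Rightarrow> real"
  assumes [measurable]: "h \<in> borel_measurable borel"
  shows "(\<integral>x. h x \<partial>uniform_measure lborel (cbox 0 1)) = (LINT x:cbox 0 1|lborel. h x)"
proof -
  have "measure lborel (cbox 0 1 :: (real ^ 'd) set) = 1"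
    using content_cube[of 1 "0 :: real ^ 'd"] by simp
  then have "emeasure lborel (cbox 0 1 :: (real ^ 'd) set) = 1"
    using emeasure_lborel_cbox_finite[of "0 :: real ^ 'd" 1]
    by (subst emeasure_eq_ennreal_measure) (auto simp: less_top)
  then have "uniform_measure lborel (cbox 0 1 :: (real ^ 'd) set)
      = density lborel (\<lambda>x. ennreal (indicator (cbox 0 1) x))"
    by (simp add: uniform_measure_def divide_ennreal_def ennreal_indicator[abs_def])
  then show ?thesis
    by (simp add: integral_density set_lebesgue_integral_def)
qed

text \<open>\<open>n \<ge> 1\<close> keeps the set of admissible errors nonempty; the real infimum
  of the empty set is unspecified.\<close>

lemma opt_quant_error_nonneg:
  assumes "n \<ge> 1"
  shows "opt_quant_error N r n P \<ge> 0"
  unfolding opt_quant_error_def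
proof (rule cInf_greatest)
  show "{quant_error N r \<Gamma> P |\<Gamma>. finite \<Gamma> \<and> \<Gamma> \<noteq> {} \<and> card \<Gamma> \<le> n} \<noteq> {}"
    using assms by (auto intro!: exI[of _ "{_}"])
qed (auto simp: quant_error_def)

text \<open>Zador's constant is an infimum over all sizes, so each single finite set bounds it from
  above. The bound is therefore not asymptotic and applies to however many points a small cube
  happens to contain.\<close>

lemma zador_const_le:
  fixes N :: "real ^ 'd \<Rightarrow> real"
  assumes N: "is_norm N" and r: "r > 0" and \<Gamma>: "finite \<Gamma>" "\<Gamma> \<noteq> {}" "card \<Gamma> \<le> m"
  shows "zador_const N r \<le>
    real m powr (1 / real CARD('d)) * (LINT \<xi>:cbox 0 1|lborel. min_dist_powr N r \<Gamma> \<xi>) powr (1 / r)"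
proof -
  let ?U = "uniform_measure lborel (cbox 0 1 :: (real ^ 'd) set)"
  have m: "m \<ge> 1"
    using \<Gamma> by (metis One_nat_def Suc_leI card_gt_0_iff le_trans)
  have "zador_const N r \<le> real m powr (1 / real CARD('d)) * opt_quant_error N r m ?U"
    unfolding zador_const_def using m
    by (intro cINF_lower bdd_belowI2[of _ 0]) (auto intro!: mult_nonneg_nonneg opt_quant_error_nonneg)
  also have "opt_quant_error N r m ?U \<le> quant_error N r \<Gamma> ?U"
    unfolding opt_quant_error_def using \<Gamma>
    by (intro cInf_lower bdd_belowI[of _ 0]) (auto simp: quant_error_def)
  finally show ?thesis
    by (simp add: quant_error_eq_min_dist_powr mult_left_mono
        integral_uniform_measure_unit_cube borel_measurable_min_dist_powr[OF N r \<Gamma>(1,2)])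
qed

text \<open>The cubes of side \<open>(2 n) powr (- 1 / d)\<close> around the points of \<open>\<Gamma>\<close> cover at most half of the
  unit cube.\<close>

lemma unit_cube_quantization_lower_bound:
  fixes N :: "real ^ 'd \<Rightarrow> real"
  assumes N: "is_norm N" and r: "r > 0" and k: "k > 0" "\<And>x. k * norm x \<le> N x"
    and \<Gamma>: "finite \<Gamma>" "\<Gamma> \<noteq> {}" "card \<Gamma> \<le> n"
  shows "k / 2 * 2 powr (- 1 / real CARD('d)) * 2 powr (- 1 / r) \<le>
    real n powr (1 / real CARD('d)) * (LINT \<xi>:cbox 0 1|lborel. min_dist_powr N r \<Gamma> \<xi>) powr (1 / r)"
proof -
  \<comment> \<open>\<open>\<rho>\<close> is half the side for which each cube has volume
    \<open>1 / (2 n)\<close>.\<close>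
  define \<rho> where "\<rho> = 1 / 2 * (2 * real n) powr (- 1 / real CARD('d))"
  define E where "E = (\<Union>x\<in>\<Gamma>. cbox (x - \<rho> *\<^sub>R 1) (x + \<rho> *\<^sub>R 1))"
  have n: "n \<ge> 1"
    using \<Gamma> by (metis One_nat_def Suc_leI card_gt_0_iff le_trans)
  have \<rho>: "\<rho> > 0"
    using n by (simp add: \<rho>_def)
  have pow: "(2 * \<rho>) ^ CARD('d) = 1 / (2 * real n)"
    using n by (simp add: \<rho>_def powr_realpow[symmetric] powr_powr powr_minus divide_simps)
  have cube: "measure lborel (cbox (x - \<rho> *\<^sub>R 1) (x + \<rho> *\<^sub>R 1)) = 1 / (2 * real n)" for x :: "real ^ 'd"
  proof -
    have "x - \<rho> *\<^sub>R 1 + (2 * \<rho>) *\<^sub>R 1 = x + \<rho> *\<^sub>R 1"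
      by (simp add: vec_eq_iff)
    moreover have "measure lborel (cbox (x - \<rho> *\<^sub>R 1) (x - \<rho> *\<^sub>R 1 + (2 * \<rho>) *\<^sub>R 1)) = 1 / (2 * real n)"
      unfolding pow[symmetric] using \<rho> by (intro content_cube) simp
    ultimately show ?thesis
      by metis
  qed
  have E_sets: "E \<in> fmeasurable lborel"
    unfolding E_def using \<Gamma>(1) by (intro fmeasurable.finite_UN) auto
  have "measure lborel E \<le> (\<Sum>x\<in>\<Gamma>. measure lborel (cbox (x - \<rho> *\<^sub>R 1) (x + \<rho> *\<^sub>R 1)))"
    unfolding E_def using \<Gamma>(1) by (intro measure_UNION_le) auto
  also have "\<dots> \<le> 1 / 2"
    using \<Gamma>(3) n by (simp add: cube field_simps)
  finally have E: "measure lborel E \<le> 1 / 2" .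
  have cube_fm: "cbox 0 1 \<in> fmeasurable (lborel :: (real ^ 'd) measure)"
    by simp
  have "measure lborel (cbox 0 1 :: (real ^ 'd) set) \<le> measure lborel ((cbox 0 1 - E) \<union> E)"
    using E_sets cube_fm by (intro measure_mono_fmeasurable fmeasurable.Un fmeasurable.Diff) auto
  also have "\<dots> \<le> measure lborel (cbox 0 1 - E) + measure lborel E"
    using E_sets by (intro measure_Un_le) (auto simp: fmeasurable_def)
  finally have half: "1 / 2 \<le> measure lborel (cbox 0 1 - E)"
    using E content_cube[of 1 "0 :: real ^ 'd"] by simp
  \<comment> \<open>Off \<open>E\<close> some coordinate of \<open>\<xi> - x\<close> exceeds
    \<open>\<rho>\<close> in absolute value, hence so does its Euclidean norm, and \<open>k\<close>
    converts this to \<open>N\<close>.\<close>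
  have far: "(k * \<rho>) powr r \<le> min_dist_powr N r \<Gamma> \<xi>" if "\<xi> \<notin> E" for \<xi>
  proof (rule min_dist_powr_ge[OF \<Gamma>(1,2)])
    fix x assume "x \<in> \<Gamma>"
    with that have "\<xi> \<notin> cbox (x - \<rho> *\<^sub>R 1) (x + \<rho> *\<^sub>R 1)"
      by (auto simp: E_def)
    then obtain i where "\<not> \<bar>(\<xi> - x) $ i\<bar> \<le> \<rho>"
      by (auto simp: mem_box_cart abs_le_iff algebra_simps)
    then have "\<rho> \<le> norm (\<xi> - x)"
      using component_le_norm_cart[of "\<xi> - x" i] by simp
    then have "k * \<rho> \<le> N (\<xi> - x)"
      using k(1) k(2)[of "\<xi> - x"] by (meson mult_left_mono less_imp_le order_trans)
    then show "(k * \<rho>) powr r \<le> N (\<xi> - x) powr r"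
      using k \<rho> r by (intro powr_mono2) auto
  qed
  have fm: "cbox 0 1 - E \<in> fmeasurable lborel"
    using E_sets cube_fm by (intro fmeasurable.Diff)
  note int = set_integrable_min_dist_powr_cbox[OF N r \<Gamma>(1,2), of 0 1]
  have "(k * \<rho>) powr r * (1 / 2) \<le> (k * \<rho>) powr r * measure lborel (cbox 0 1 - E)"
    using half by (intro mult_left_mono) auto
  also have "\<dots> = (LINT \<xi>:cbox 0 1 - E|lborel. (k * \<rho>) powr r)"
    using fm by (simp add: set_lebesgue_integral_def fmeasurable_def)
  also have "\<dots> \<le> (LINT \<xi>:cbox 0 1 - E|lborel. min_dist_powr N r \<Gamma> \<xi>)"
    using fm far int by (intro set_integral_mono set_integrable_subset[OF int])
       (auto simp: set_integrable_def fmeasurable_def)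
  also have "\<dots> \<le> (LINT \<xi>:cbox 0 1|lborel. min_dist_powr N r \<Gamma> \<xi>)"
    using fm int min_dist_powr_nonneg[OF \<Gamma>(1,2)]
    by (intro set_integral_mono_set[OF int]) (auto simp: fmeasurable_def)
  finally have "((k * \<rho>) powr r * (1 / 2)) powr (1 / r)
      \<le> (LINT \<xi>:cbox 0 1|lborel. min_dist_powr N r \<Gamma> \<xi>) powr (1 / r)"
    using r by (intro powr_mono2) auto
  moreover have "((k * \<rho>) powr r * (1 / 2)) powr (1 / r) = k * \<rho> * 2 powr (- 1 / r)"
    using k \<rho> r by (simp add: powr_mult powr_powr powr_minus powr_divide divide_simps)
  ultimately have "real n powr (1 / real CARD('d)) * (k * \<rho> * 2 powr (- 1 / r)) \<le>
     real n powr (1 / real CARD('d)) * (LINT \<xi>:cbox 0 1|lborel. min_dist_powr N r \<Gamma> \<xi>) powr (1 / r)"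
    by (intro mult_left_mono) auto
  moreover have "real n powr (1 / real CARD('d)) * (k * \<rho> * 2 powr (- 1 / r))
      = k / 2 * 2 powr (- 1 / real CARD('d)) * 2 powr (- 1 / r)"
    using n by (simp add: \<rho>_def powr_mult powr_minus divide_simps)
  ultimately show ?thesis by (simp only:)
qed

text \<open>The preceding lower bound depends neither on \<open>n\<close> nor on the set, so it
  passes to both infima. Positivity is what later permits division by the constant.\<close>

lemma zador_const_pos:
  fixes N :: "real ^ 'd \<Rightarrow> real"
  assumes N: "is_norm N" and r: "r > 0"
  shows "zador_const N r > 0"
proof -
  obtain k where k: "k > 0" "\<And>x. k * norm x \<le> N x"
    using is_norm_lower_bound[OF N] by blast
  define K where "K = k / 2 * 2 powr (- 1 / real CARD('d)) * 2 powr (- 1 / r)"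
  let ?U = "uniform_measure lborel (cbox 0 1 :: (real ^ 'd) set)"
  have "K > 0"
    using k by (simp add: K_def)
  also have "K \<le> zador_const N r"
    unfolding zador_const_def
  proof (rule cINF_greatest)
    fix n :: nat assume "n \<in> {1..}"
    then have n: "n \<ge> 1" by simp
    have "K / real n powr (1 / real CARD('d)) \<le> opt_quant_error N r n ?U"
      unfolding opt_quant_error_def
    proof (rule cInf_greatest)
      show "{quant_error N r \<Gamma> ?U |\<Gamma>. finite \<Gamma> \<and> \<Gamma> \<noteq> {} \<and> card \<Gamma> \<le> n} \<noteq> {}"
        using n by (auto intro!: exI[of _ "{_}"])
      fix e assume "e \<in> {quant_error N r \<Gamma> ?U |\<Gamma>. finite \<Gamma> \<and> \<Gamma> \<noteq> {} \<and> card \<Gamma> \<le> n}"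
      then obtain \<Gamma> where \<Gamma>: "finite \<Gamma>" "\<Gamma> \<noteq> {}" "card \<Gamma> \<le> n" and e: "e = quant_error N r \<Gamma> ?U"
        by blast
      have "K \<le> real n powr (1 / real CARD('d)) * e"
        using unit_cube_quantization_lower_bound[OF N r k \<Gamma>]
        by (simp add: K_def e quant_error_eq_min_dist_powr integral_uniform_measure_unit_cube
            borel_measurable_min_dist_powr[OF N r \<Gamma>(1,2)])
      then show "K / real n powr (1 / real CARD('d)) \<le> e"
        using n by (simp add: divide_simps mult.commute)
    qed
    then show "K \<le> real n powr (1 / real CARD('d)) * opt_quant_error N r n ?U"
      using n by (simp add: divide_simps mult.commute)
  qed auto
  finally show ?thesis .
qed

text \<open>Mapping the cube affinely onto the unit cube costs a factor \<open>l ^ d\<close> for the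
  volume and \<open>l powr r\<close> for the distances. On the unit cube it remains to raise
  \<open>zador_const_le\<close> to the power \<open>r\<close>.\<close>

lemma cube_quantization_lower_bound:
  fixes N :: "real ^ 'd \<Rightarrow> real" and u :: "real ^ 'd"
  assumes N: "is_norm N" and r: "r > 0" and \<Gamma>: "finite \<Gamma>" "\<Gamma> \<noteq> {}" and l: "l > 0"
  shows "zador_const N r powr r * real (card \<Gamma>) powr (- r / real CARD('d)) * l powr (real CARD('d) + r)
    \<le> (LINT \<xi>:cbox u (u + l *\<^sub>R 1)|lborel. min_dist_powr N r \<Gamma> \<xi>)"
proof -
  let ?d = "real CARD('d)"
  define \<Gamma>' where "\<Gamma>' = (\<lambda>x. (1 / l) *\<^sub>R (x - u)) ` \<Gamma>"
  have \<Gamma>': "finite \<Gamma>'" "\<Gamma>' \<noteq> {}" "card \<Gamma>' \<le> card \<Gamma>"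
    using \<Gamma> by (auto simp: \<Gamma>'_def card_image_le)
  have m: "card \<Gamma> > 0"
    using \<Gamma> by (simp add: card_gt_0_iff)
  have scale: "min_dist_powr N r \<Gamma> (u + l *\<^sub>R y) = l powr r * min_dist_powr N r \<Gamma>' y" for y
  proof -
    have "N (u + l *\<^sub>R y - x) = l * N (y - (1 / l) *\<^sub>R (x - u))" for x
    proof -
      have "u + l *\<^sub>R y - x = l *\<^sub>R (y - (1 / l) *\<^sub>R (x - u))"
        using l by (simp add: algebra_simps)
      then show ?thesis
        using l by (simp add: is_norm_scale[OF N])
    qed
    then have eq: "N (u + l *\<^sub>R y - x) powr r = l powr r * N (y - (1 / l) *\<^sub>R (x - u)) powr r" for x
      using l by (simp add: powr_mult is_norm_nonneg[OF N])
    have "l powr r * min_dist_powr N r \<Gamma>' y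
        = Min ((\<lambda>t. l powr r * t) ` (\<lambda>x. N (y - x) powr r) ` \<Gamma>')"
      unfolding min_dist_powr_def using \<Gamma>'
      by (intro mono_Min_commute monoI mult_left_mono) auto
    then show ?thesis
      by (simp add: min_dist_powr_def \<Gamma>'_def image_image eq)
  qed
  define X where "X = (LINT \<xi>:cbox 0 1|lborel. min_dist_powr N r \<Gamma>' \<xi>)"
  have X: "X \<ge> 0"
    unfolding X_def set_lebesgue_integral_def using min_dist_powr_nonneg[OF \<Gamma>'(1,2)]
    by (intro integral_nonneg_AE) auto
  have ind: "indicator (cbox u (u + l *\<^sub>R 1)) (u + l *\<^sub>R y) = (indicator (cbox 0 1) y :: real)"
    for y :: "real ^ 'd"
    using l by (simp add: indicator_def mem_box_cart zero_le_mult_iff)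
  have "(LINT \<xi>:cbox u (u + l *\<^sub>R 1)|lborel. min_dist_powr N r \<Gamma> \<xi>) = l ^ CARD('d) * (l powr r * X)"
    unfolding set_lebesgue_integral_def X_def
    using l borel_measurable_min_dist_powr[OF N r \<Gamma>]
    by (subst lborel_integral_affine[of _ l u]) (auto simp: ind scale algebra_simps)
  also have "\<dots> = l powr (?d + r) * X"
    using l by (simp add: powr_add powr_realpow)
  finally have eq: "(LINT \<xi>:cbox u (u + l *\<^sub>R 1)|lborel. min_dist_powr N r \<Gamma> \<xi>) = l powr (?d + r) * X" .
  have "zador_const N r powr r \<le> (real (card \<Gamma>) powr (1 / ?d) * X powr (1 / r)) powr r"
    using zador_const_le[OF N r \<Gamma>'] zador_const_pos[OF N r] r
    unfolding X_def[symmetric] by (intro powr_mono2) auto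
  also have "\<dots> = real (card \<Gamma>) powr (r / ?d) * X"
    using X r by (simp add: powr_mult powr_powr)
  finally have "zador_const N r powr r * real (card \<Gamma>) powr (- r / ?d) \<le> X"
    using m by (simp add: powr_minus divide_simps mult.commute)
  then show ?thesis
    unfolding eq by (simp add: mult.commute[of "l powr _"] mult_right_mono)
qed

section \<open>Lower sums over cubes and the tangent inequality\<close>

text \<open>With \<open>z = y / (k * x)\<close> this is the tangent inequality
  \<open>1 + a - a * z \<le> z powr (- a)\<close> at \<open>z = 1\<close>, multiplied by
  \<open>x * k powr (- a)\<close>. Equality holds for \<open>y = k * x\<close>, so \<open>k\<close>
  is the ratio of points to mass at which the bound is sharp. The left side is linear in
  \<open>x\<close> and \<open>y\<close> and can be summed over cubes.\<close>

lemma powr_tangent_bound: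
  fixes x y a k :: real
  assumes "x > 0" "y > 0" "a > 0" "k > 0"
  shows "(1 + a) * k powr (- a) * x - a * k powr (- a - 1) * y \<le> x powr (1 + a) * y powr (- a)"
proof -
  define z where "z = y / (k * x)"
  have z: "z > 0" and y: "y = k * x * z"
    using assms by (auto simp: z_def)
  have "a * ln z \<le> a * (z - 1)"
    using ln_le_minus_one[OF z] assms(3) by (intro mult_left_mono) auto
  then have "1 + a - a * z \<le> 1 - a * ln z"
    by (simp add: algebra_simps)
  also have "\<dots> \<le> z powr (- a)"
    using z exp_ge_add_one_self[of "- a * ln z"] by (simp add: powr_def)
  finally have "x * k powr (- a) * (1 + a - a * z) \<le> x * k powr (- a) * z powr (- a)"
    using assms by (intro mult_left_mono) auto
  moreover have "x * k powr (- a) * z powr (- a) = x powr (1 + a) * y powr (- a)"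
    using assms z by (simp add: y powr_mult powr_add powr_minus divide_simps)
  moreover have "x * k powr (- a) * (1 + a - a * z)
      = (1 + a) * k powr (- a) * x - a * k powr (- a - 1) * y"
  proof -
    have "k powr (- a - 1) * k = k powr (- a)"
      using assms by (simp add: powr_diff)
    then have "k powr (- a - 1) * y = k powr (- a) * (x * z)"
      by (simp add: y mult.assoc[symmetric])
    then show ?thesis
      by (simp add: algebra_simps)
  qed
  ultimately show ?thesis by simp
qed

section \<open>Approximation of an integral over an open set by lower sums over cubes\<close>

lemma measure_density_eq_set_integral:
  fixes g :: "'a \<Rightarrow> real"
  assumes [measurable]: "g \<in> borel_measurable M" "A \<in> sets M" and "\<And>x. 0 \<le> g x"
  shows "measure (density M (\<lambda>x. ennreal (g x))) A = (LINT x:A|M. g x)"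
proof -
  have "measure (density M (\<lambda>x. ennreal (g x))) A
      = (\<integral>x. indicator A x \<partial>density M (\<lambda>x. ennreal (g x)))"
    by (simp add: sets.Int_space_eq2)
  also have "\<dots> = (\<integral>x. g x *\<^sub>R indicator A x \<partial>M)"
    using assms(3) by (intro integral_density) auto
  finally show ?thesis
    by (simp add: set_lebesgue_integral_def mult.commute)
qed

lemma finite_measure_density_integrable:
  fixes g :: "'a \<Rightarrow> real"
  assumes "integrable M g" "\<And>x. 0 \<le> g x"
  shows "finite_measure (density M (\<lambda>x. ennreal (g x)))"
proof (rule finite_measureI)
  have [measurable]: "g \<in> borel_measurable M"
    using assms(1) by simp
  have "emeasure (density M (\<lambda>x. ennreal (g x))) (space M) = (\<integral>\<^sup>+x. ennreal (g x) \<partial>M)"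
    by (subst emeasure_density) (auto intro!: nn_integral_cong)
  also have "\<dots> = ennreal (\<integral>x. g x \<partial>M)"
    using assms by (intro nn_integral_eq_integral) auto
  finally show "emeasure (density M (\<lambda>x. ennreal (g x))) (space (density M (\<lambda>x. ennreal (g x)))) \<noteq> \<infinity>"
    by simp
qed

lemma mem_centered_cube_iff:
  fixes x :: "real ^ 'd"
  shows "x \<in> cbox (- R *\<^sub>R 1) (R *\<^sub>R 1) \<longleftrightarrow> (\<forall>i. \<bar>x $ i\<bar> \<le> R)"
  by (simp add: mem_box_cart abs_le_iff minus_le_iff) blast

text \<open>\<open>covering_lemma\<close> cuts dyadically; starting from a cube, all cells are
  cubes. The bound \<open>R\<close> is there because it covers only subsets of one compact
  box.\<close>

lemma open_covered_by_small_cubes: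
  fixes B :: "(real ^ 'd) set"
  assumes "open B" "R > 0" and \<delta>: "\<And>x. x \<in> B \<Longrightarrow> \<delta> x > 0"
  obtains \<D> where "countable \<D>"
    "\<And>K. K \<in> \<D> \<Longrightarrow> \<exists>u l. 0 < l \<and> K = cbox u (u + l *\<^sub>R 1)"
    "pairwise (\<lambda>K L. interior K \<inter> interior L = {}) \<D>"
    "\<And>K. K \<in> \<D> \<Longrightarrow> K \<subseteq> B \<and> (\<exists>x\<in>B. K \<subseteq> ball x (\<delta> x))"
    "B \<inter> cbox (- R *\<^sub>R 1) (R *\<^sub>R 1) \<subseteq> \<Union>\<D>"
proof -
  \<comment> \<open>Intersecting with \<open>B\<close> keeps the cells inside \<open>B\<close>. Off
    \<open>B\<close> the ball serves only to make \<open>\<gamma>\<close> a gauge on the whole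
    space.\<close>
  define \<gamma> where "\<gamma> x = (if x \<in> B then ball x (\<delta> x) \<inter> B else ball x 1)" for x
  have \<gamma>: "gauge \<gamma>"
    using \<open>open B\<close> \<delta> by (auto simp: gauge_def \<gamma>_def)
  have ne: "box (- R *\<^sub>R 1) (R *\<^sub>R 1) \<noteq> ({} :: (real ^ 'd) set)"
    using \<open>R > 0\<close> by (auto simp: interval_ne_empty_cart)
  obtain \<D> where \<D>: "countable \<D>"
    "\<And>K. K \<in> \<D> \<Longrightarrow> interior K \<noteq> {} \<and> (\<exists>c d. K = cbox c d)"
    "pairwise (\<lambda>K L. interior K \<inter> interior L = {}) \<D>"
    "\<And>K. K \<in> \<D> \<Longrightarrow> \<exists>x \<in> (B \<inter> cbox (- R *\<^sub>R 1) (R *\<^sub>R 1)) \<inter> K. K \<subseteq> \<gamma> x"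
    "\<And>u v. cbox u v \<in> \<D> \<Longrightarrow> \<exists>n. \<forall>i \<in> Basis. v \<bullet> i - u \<bullet> i = ((R *\<^sub>R 1) \<bullet> i - (- R *\<^sub>R 1) \<bullet> i) / 2^n"
    "B \<inter> cbox (- R *\<^sub>R 1) (R *\<^sub>R 1) \<subseteq> \<Union>\<D>"
    by (rule covering_lemma[OF _ ne \<gamma>, of "B \<inter> cbox (- R *\<^sub>R 1) (R *\<^sub>R 1)"]) auto
  show thesis
  proof (rule that[OF \<D>(1) _ \<D>(3) _ \<D>(6)])
    fix K assume K: "K \<in> \<D>"
    show "\<exists>u l. 0 < l \<and> K = cbox u (u + l *\<^sub>R 1)"
    proof -
      obtain u v where uv: "K = cbox u v"
        using \<D>(2)[OF K] by blast
      obtain n where n: "\<forall>i \<in> Basis. v \<bullet> i - u \<bullet> i = ((R *\<^sub>R 1) \<bullet> i - (- R *\<^sub>R 1) \<bullet> i) / 2^n"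
        using \<D>(5) K uv by blast
      have "v $ i - u $ i = 2 * R / 2 ^ n" for i
        using n[rule_format, of "axis i 1"] by (simp add: inner_axis axis_in_Basis_iff)
      then have "v = u + (2 * R / 2 ^ n) *\<^sub>R 1"
        by (simp add: vec_eq_iff algebra_simps)
      then show ?thesis
        using uv \<open>R > 0\<close> by (intro exI[of _ u] exI[of _ "2 * R / 2 ^ n"]) auto
    qed
    show "K \<subseteq> B \<and> (\<exists>x\<in>B. K \<subseteq> ball x (\<delta> x))"
      using \<D>(4)[OF K] by (auto simp: \<gamma>_def)
  qed
qed

text \<open>Continuity of the measure from below along an enumeration of the family. The empty
  family is split off because it has no enumeration by \<open>from_nat_into\<close>.\<close>

lemma finite_subfamily_approx:
  fixes M :: "'a measure"
  assumes "finite_measure M" "countable \<D>" "\<D> \<subseteq> sets M" "m < measure M (\<Union>\<D>)"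
  obtains \<F> where "finite \<F>" "\<F> \<subseteq> \<D>" "m < measure M (\<Union>\<F>)"
proof (cases "\<D> = {}")
  case True
  with that[of "{}"] assms show thesis by simp
next
  case False
  interpret finite_measure M by fact
  let ?K = "from_nat_into \<D>"
  have K: "range ?K = \<D>"
    using False assms(2) by (rule range_from_nat_into)
  have K_sets: "?K i \<in> sets M" for i
    using from_nat_into[OF False, of i] assms(3) by auto
  have "(\<lambda>k. measure M (\<Union>i\<le>k. ?K i)) \<longlonglongrightarrow> measure M (\<Union>k. \<Union>i\<le>k. ?K i)"
  proof (rule finite_Lim_measure_incseq)
    show "range (\<lambda>k. \<Union>i\<le>k. ?K i) \<subseteq> sets M"
      using K_sets by (intro image_subsetI sets.finite_UN) auto
    show "incseq (\<lambda>k. \<Union>i\<le>k. ?K i)"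
      by (intro incseq_SucI UN_mono) auto
  qed
  also have "(\<Union>k. \<Union>i\<le>k. ?K i) = \<Union>(range ?K)"
    by auto
  also have "\<dots> = \<Union>\<D>"
    by (simp only: K)
  finally have "\<forall>\<^sub>F k in sequentially. m < measure M (\<Union>i\<le>k. ?K i)"
    using assms(4) by (rule order_tendstoD)
  then obtain k where "m < measure M (\<Union>i\<le>k. ?K i)"
    using eventually_sequentially by auto
  then show thesis
    using K by (intro that[of "?K ` {..k}"]) (simp, blast, simp)
qed

text \<open>The oscillation is controlled in relative terms, so that the resulting loss in an
  integral is a fraction of the integral, however large the domain.\<close>

lemma continuous_pos_small_oscillation:
  fixes g :: "'a :: metric_space \<Rightarrow> real"
  assumes g: "continuous_on UNIV g" "g x > 0" and q: "0 < q" "q < 1"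
  shows "\<exists>\<delta>>0. \<forall>y\<in>ball x \<delta>. \<forall>z\<in>ball x \<delta>. q * g y \<le> g z"
proof -
  \<comment> \<open>For this choice \<open>1 - \<tau> - q * (1 + \<tau>)\<close> equals half the
    square of \<open>1 - q\<close>.\<close>
  define \<tau> where "\<tau> = (1 - q) / 2"
  have \<tau>: "\<tau> > 0" "q * (1 + \<tau>) \<le> 1 - \<tau>"
    using q zero_le_square[of "1 - q"] by (auto simp: \<tau>_def field_simps)
  have "\<tau> * g x > 0"
    using \<tau>(1) g(2) by simp
  then obtain \<delta> where \<delta>: "\<delta> > 0" "\<And>y. dist y x < \<delta> \<Longrightarrow> dist (g y) (g x) < \<tau> * g x"
    using g(1) unfolding continuous_on_iff by blast
  have "q * g y \<le> g z" if "y \<in> ball x \<delta>" "z \<in> ball x \<delta>" for y z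
  proof -
    have "g y \<le> (1 + \<tau>) * g x" "(1 - \<tau>) * g x \<le> g z"
      using \<delta>(2)[of y] \<delta>(2)[of z] that by (auto simp: dist_real_def dist_commute algebra_simps)
    then have "q * g y \<le> q * (1 + \<tau>) * g x"
      using q by (simp add: mult.assoc mult_left_mono)
    also have "\<dots> \<le> (1 - \<tau>) * g x"
      using \<tau>(2) g(2) by (intro mult_right_mono) auto
    finally show ?thesis
      using \<open>(1 - \<tau>) * g x \<le> g z\<close> by simp
  qed
  then show ?thesis using \<delta>(1) by blast
qed

text \<open>Everything is measured by the finite measure \<open>G\<close> with density
  \<open>g\<close>. Restricting to finitely many cubes costs at most \<open>\<epsilon> / 2\<close>
  of the mass \<open>T\<close> of \<open>B\<close>; replacing \<open>g\<close> by its minimum on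
  each cube costs at most the fraction \<open>1 - q\<close>, which is again at most
  \<open>\<epsilon> / 2\<close>.\<close>

lemma open_set_integral_lower_sum:
  fixes g :: "real ^ 'd \<Rightarrow> real"
  assumes cont: "continuous_on UNIV g" and pos: "\<And>x. g x > 0" and int: "integrable lborel g"
    and "open B" "\<epsilon> > 0"
  obtains \<F> where "finite \<F>"
    "\<And>K. K \<in> \<F> \<Longrightarrow> \<exists>u l. 0 < l \<and> K = cbox u (u + l *\<^sub>R 1)"
    "pairwise (\<lambda>K L. interior K \<inter> interior L = {}) \<F>"
    "\<And>K. K \<in> \<F> \<Longrightarrow> K \<subseteq> B"
    "(LINT x:B|lborel. g x) - \<epsilon> \<le> (\<Sum>K\<in>\<F>. Inf (g ` K) * measure lborel K)"
proof -
  define G where "G = density lborel (\<lambda>x. ennreal (g x))"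
  have [measurable]: "g \<in> borel_measurable borel"
    using int by auto
  have g0: "0 \<le> g x" for x
    using pos[of x] by simp
  interpret G: finite_measure G
    unfolding G_def using int g0 by (rule finite_measure_density_integrable)
  have sets_G: "sets G = sets borel"
    by (simp add: G_def)
  have measure_G: "measure G A = (LINT x:A|lborel. g x)" if "A \<in> sets borel" for A
    unfolding G_def using that g0 by (intro measure_density_eq_set_integral) auto
  have B: "B \<in> sets borel"
    using \<open>open B\<close> by simp
  define T where "T = measure G B"
  \<comment> \<open>The second term of the minimum gives
    \<open>(1 - q) * T \<le> \<epsilon> / 2\<close>, the first keeps \<open>q\<close>
    positive.\<close>
  define q where "q = 1 - min (1 / 2) (\<epsilon> / (2 * (T + 1)))"
  have T: "T \<ge> 0"
    by (simp add: T_def)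
  have q: "0 < q" "q < 1"
    using T \<open>\<epsilon> > 0\<close> by (auto simp: q_def min_def)
  have "(1 - q) * T \<le> \<epsilon> / (2 * (T + 1)) * T"
    using T by (intro mult_right_mono) (auto simp: q_def)
  also have "\<dots> \<le> \<epsilon> / 2"
    using T \<open>\<epsilon> > 0\<close> by (simp add: field_simps)
  finally have qT: "(1 - q) * T \<le> \<epsilon> / 2" .
  \<comment> \<open>\<open>Suc k\<close> makes even the first cube nondegenerate, as the covering
    lemma demands.\<close>
  define C :: "nat \<Rightarrow> (real ^ 'd) set"
    where "C k = cbox (- real (Suc k) *\<^sub>R 1) (real (Suc k) *\<^sub>R 1)" for k
  have C_iff: "x \<in> C k \<longleftrightarrow> (\<forall>i. \<bar>x $ i\<bar> \<le> real (Suc k))" for x k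
    unfolding C_def by (rule mem_centered_cube_iff)
  have "(\<lambda>k. measure G (B \<inter> C k))
      \<longlonglongrightarrow> measure G (\<Union>k. B \<inter> C k)"
  proof (rule G.finite_Lim_measure_incseq)
    show "range (\<lambda>k. B \<inter> C k) \<subseteq> sets G"
      using B by (auto simp: sets_G C_def)
    show "incseq (\<lambda>k. B \<inter> C k)"
    proof (rule incseq_SucI)
      have "real (Suc k) \<le> real (Suc (Suc k))" for k
        by simp
      then show "B \<inter> C k \<subseteq> B \<inter> C (Suc k)" for k
        using C_iff by (meson Int_mono order_refl order_trans subsetI)
    qed
  qed
  also have "(\<Union>k. B \<inter> C k) = B"
  proof (intro equalityI subsetI)
    fix x assume "x \<in> B"
    obtain k :: nat where k: "norm x \<le> real k"
      using real_arch_simple by blast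
    have "\<bar>x $ i\<bar> \<le> real (Suc k)" for i
      using component_le_norm_cart[of x i] k by simp
    then have "x \<in> C k"
      unfolding C_iff by blast
    with \<open>x \<in> B\<close> show "x \<in> (\<Union>k. B \<inter> C k)"
      by blast
  qed auto
  finally have "\<forall>\<^sub>F k in sequentially. T - \<epsilon> / 2 < measure G (B \<inter> C k)"
    using \<open>\<epsilon> > 0\<close> by (intro order_tendstoD(1)) (auto simp: T_def)
  then obtain k where k: "T - \<epsilon> / 2 < measure G (B \<inter> C k)"
    using eventually_sequentially by auto
  obtain \<delta> where \<delta>: "\<And>x. \<delta> x > 0" "\<And>x y z. y \<in> ball x (\<delta> x) \<Longrightarrow> z \<in> ball x (\<delta> x) \<Longrightarrow> q * g y \<le> g z"
    using continuous_pos_small_oscillation[OF cont pos q] by metis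
  have "real (Suc k) > 0"
    by simp
  from open_covered_by_small_cubes[OF \<open>open B\<close> this, of \<delta>, folded C_def] \<delta>(1)
  obtain \<D> where \<D>: "countable \<D>"
    "\<And>K. K \<in> \<D> \<Longrightarrow> \<exists>u l. 0 < l \<and> K = cbox u (u + l *\<^sub>R 1)"
    "pairwise (\<lambda>K L. interior K \<inter> interior L = {}) \<D>"
    "\<And>K. K \<in> \<D> \<Longrightarrow> K \<subseteq> B \<and> (\<exists>x\<in>B. K \<subseteq> ball x (\<delta> x))"
    "B \<inter> C k \<subseteq> \<Union>\<D>"
    by blast
  have \<D>_sets: "\<D> \<subseteq> sets G"
    using \<D>(2) by (force simp: sets_G)
  have "T - \<epsilon> / 2 < measure G (\<Union>\<D>)"
    using k G.finite_measure_mono[OF \<D>(5)] \<D>_sets \<D>(1) by (force intro: sets.countable_Union)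
  then obtain \<F> where \<F>: "finite \<F>" "\<F> \<subseteq> \<D>" "T - \<epsilon> / 2 < measure G (\<Union>\<F>)"
    using finite_subfamily_approx[OF G.finite_measure_axioms \<D>(1) \<D>_sets] by blast
  have cell: "q * measure G K \<le> Inf (g ` K) * measure lborel K" if "K \<in> \<F>" for K
  proof -
    obtain u l where K: "0 < l" "K = cbox u (u + l *\<^sub>R 1)"
      using \<D>(2) \<F>(2) \<open>K \<in> \<F>\<close> by blast
    obtain x where x: "K \<subseteq> ball x (\<delta> x)"
      using \<D>(4) \<F>(2) \<open>K \<in> \<F>\<close> by blast
    have K_ne: "K \<noteq> {}"
      using K by (auto simp: interval_ne_empty_cart)
    have "q * g y \<le> Inf (g ` K)" if "y \<in> K" for y
      using K_ne x that \<delta>(2)[of _ x] by (intro cInf_greatest) (auto simp: subset_iff)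
    moreover have "set_integrable lborel K (\<lambda>y. q * g y)" "set_integrable lborel K (\<lambda>y. Inf (g ` K))"
      using K continuous_on_subset[OF cont]
      by (auto intro!: set_integrable_continuous_compact continuous_intros)
    ultimately have "(LINT y:K|lborel. q * g y) \<le> (LINT y:K|lborel. Inf (g ` K))"
      by (intro set_integral_mono) auto
    then show ?thesis
      using K by (simp add: measure_G set_lebesgue_integral_def mult.commute)
  qed
  have "T - \<epsilon> \<le> q * T - \<epsilon> / 2"
    using qT by (simp add: algebra_simps)
  also have "\<dots> \<le> q * (T - \<epsilon> / 2)"
    using q \<open>\<epsilon> > 0\<close> by (simp add: algebra_simps)
  also have "\<dots> \<le> q * measure G (\<Union>\<F>)"
    using q \<F>(3) by (intro mult_left_mono) auto
  also have "\<dots> \<le> q * (\<Sum>K\<in>\<F>. measure G K)"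
    using q \<F> \<D>_sets measure_UNION_le[of \<F> "\<lambda>K. K" G] by (intro mult_left_mono) auto
  also have "\<dots> \<le> (\<Sum>K\<in>\<F>. Inf (g ` K) * measure lborel K)"
    unfolding sum_distrib_left by (intro sum_mono cell)
  finally have sum: "(LINT x:B|lborel. g x) - \<epsilon> \<le> (\<Sum>K\<in>\<F>. Inf (g ` K) * measure lborel K)"
    by (simp add: T_def measure_G B)
  show thesis
  proof (rule that[OF \<F>(1) _ pairwise_subset[OF \<D>(3) \<F>(2)] _ sum])
    fix K assume "K \<in> \<F>"
    with \<F>(2) have "K \<in> \<D>" by blast
    then show "\<exists>u l. 0 < l \<and> K = cbox u (u + l *\<^sub>R 1)" "K \<subseteq> B"
      using \<D>(2,4) by blast+
  qed
qed

section \<open>From one-sided tangent bounds to a limit\<close>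

text \<open>Numerator and denominator vanish at 1 and have the same nonzero derivative
  \<open>- a * (1 + a)\<close> there; dividing both by \<open>t - 1\<close> exposes the two
  difference quotients.\<close>

lemma powr_quotient_tendsto_1:
  fixes a :: real
  assumes "a > 0"
  shows "((\<lambda>t. ((1 + a) * (t powr (- a) - 1)) / (a * (t powr (- a - 1) - 1))) \<longlongrightarrow> 1) (at 1)"
proof -
  have lim: "((\<lambda>t. (t powr b - 1) / (t - 1)) \<longlongrightarrow> b) (at 1)" for b :: real
  proof -
    have "((\<lambda>t. t powr b) has_real_derivative b) (at 1)"
      by (auto intro!: derivative_eq_intros)
    then show ?thesis
      by (simp add: has_field_derivative_iff)
  qed
  have "((\<lambda>t. ((1 + a) * ((t powr (- a) - 1) / (t - 1))) / (a * ((t powr (- a - 1) - 1) / (t - 1))))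
     \<longlongrightarrow> ((1 + a) * (- a)) / (a * (- a - 1))) (at 1)"
    using assms by (intro tendsto_intros lim) (simp add: mult_eq_0_iff)
  also have "a * (- a - 1) = (1 + a) * (- a)"
    by (simp add: algebra_simps)
  also have "((1 + a) * (- a)) / ((1 + a) * (- a)) = 1"
    using assms by simp
  finally show ?thesis
  proof (rule Lim_transform_eventually)
    show "\<forall>\<^sub>F t in at 1. ((1 + a) * ((t powr (- a) - 1) / (t - 1))) / (a * ((t powr (- a - 1) - 1) / (t - 1)))
        = ((1 + a) * (t powr (- a) - 1)) / (a * (t powr (- a - 1) - 1))"
      by (auto simp: eventually_at_filter)
  qed
qed

text \<open>The factor of \<open>u n\<close> is positive for \<open>t < 1\<close> and negative for
  \<open>t > 1\<close>, so the same inequality bounds \<open>u n\<close> from below in the first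
  case and from above in the second. Both bounds approach \<open>q\<close> as \<open>t\<close> tends
  to 1.\<close>

lemma tendsto_from_tangent_bounds:
  fixes u :: "nat \<Rightarrow> real" and a q :: real
  assumes a: "a > 0" and bound: "\<And>t \<delta>. t > 0 \<Longrightarrow> \<delta> > 0 \<Longrightarrow>
      \<forall>\<^sub>F n in sequentially. (1 + a) * (t powr (- a) - 1) * q - \<delta> \<le> a * (t powr (- a - 1) - 1) * u n"
  shows "u \<longlonglongrightarrow> q"
proof -
  define num den where "num t = (1 + a) * (t powr (- a) - 1)" and "den t = a * (t powr (- a - 1) - 1)" for t
  have lim: "((\<lambda>t. num t / den t * q) \<longlongrightarrow> q) (at 1)"
    using tendsto_mult_right[OF powr_quotient_tendsto_1[OF a], of q] by (simp add: num_def den_def)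
  have bound': "\<forall>\<^sub>F n in sequentially. num t * q - \<delta> \<le> den t * u n" if "t > 0" "\<delta> > 0" for t \<delta>
    using bound[OF that] by (simp add: num_def den_def)
  show ?thesis
  proof (rule order_tendstoI)
    fix l assume "l < q"
    have "\<forall>\<^sub>F t in at_left 1. l < num t / den t * q"
      using order_tendstoD(1)[OF lim \<open>l < q\<close>] by (auto simp: eventually_at_split)
    moreover have "\<forall>\<^sub>F t in at_left (1::real). t \<in> {0<..<1}"
      by (rule eventually_at_left_real) simp
    ultimately have "\<forall>\<^sub>F t in at_left 1. l < num t / den t * q \<and> t \<in> {0<..<1}"
      by (rule eventually_conj)
    then obtain t where t: "l < num t / den t * q" "0 < t" "t < 1"
      using eventually_happens'[OF trivial_limit_at_left_real] by auto
    have den: "den t > 0"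
      using t a powr_less_mono2_neg[of "- a - 1" t 1] by (simp add: den_def)
    \<comment> \<open>The slack in the bound at \<open>t\<close>; taking half of it as
      \<open>\<delta>\<close> leaves a strict inequality.\<close>
    define e where "e = num t * q - den t * l"
    have e: "e > 0"
      using t(1) den by (simp add: e_def field_simps)
    from bound'[OF t(2) half_gt_zero[OF e]]
    show "\<forall>\<^sub>F n in sequentially. l < u n"
    proof eventually_elim
      case (elim n)
      with e have "den t * l < den t * u n"
        unfolding e_def by argo
      then show ?case using den by simp
    qed
  next
    fix l assume "q < l"
    have "\<forall>\<^sub>F t in at_right 1. num t / den t * q < l"
      using order_tendstoD(2)[OF lim \<open>q < l\<close>] by (auto simp: eventually_at_split)
    moreover have "\<forall>\<^sub>F t in at_right (1::real). t \<in> {1<..<2}"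
      by (rule eventually_at_right_real) simp
    ultimately have "\<forall>\<^sub>F t in at_right 1. num t / den t * q < l \<and> t \<in> {1<..<2}"
      by (rule eventually_conj)
    then obtain t where t: "num t / den t * q < l" "1 < t"
      using eventually_happens'[OF trivial_limit_at_right_real] by auto
    have den: "den t < 0"
      using t a powr_less_mono2_neg[of "- a - 1" 1 t] by (simp add: den_def mult_pos_neg)
    define e where "e = num t * q - den t * l"
    have e: "e > 0"
      using t(1) den by (simp add: e_def field_simps)
    with t(2) have "\<forall>\<^sub>F n in sequentially. num t * q - e / 2 \<le> den t * u n"
      by (intro bound') auto
    then show "\<forall>\<^sub>F n in sequentially. u n < l"
    proof eventually_elim
      case (elim n)
      with e have "den t * l < den t * u n"
        unfolding e_def by argo
      then show ?case using den by simp
    qed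
  qed
qed

section \<open>Local lower bounds for asymptotically optimal quantizers\<close>

text \<open>Continuity and positivity make the density nearly constant, in relative terms, on small
  cubes. The exponential form enters only in the final theorem.\<close>

locale asymp_optimal_quantizers =
  fixes N :: "real ^ 'd \<Rightarrow> real" and r :: real and f :: "real ^ 'd \<Rightarrow> real"
    and \<Gamma> :: "nat \<Rightarrow> (real ^ 'd) set"
  assumes norm_N: "is_norm N" and r_pos: "r > 0"
    and f_cont: "continuous_on UNIV f" and f_pos: "\<And>x. f x > 0"
    and integrable_f_powr: "integrable lborel (\<lambda>x. f x powr (real CARD('d) / (real CARD('d) + r)))"
    and optimal: "asymp_optimal N r f \<Gamma>"
begin

definition a where "a = r / real CARD('d)"
text \<open>The limiting density of the quantizer points, up to the normalization by
  \<open>I\<close>.\<close>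

definition g where "g x = f x powr (real CARD('d) / (real CARD('d) + r))"
definition I where "I = (\<integral>x. g x \<partial>lborel)"
definition J where "J = zador_const N r"
definition h where "h n \<xi> = f \<xi> * min_dist_powr N r (\<Gamma> n) \<xi>"
text \<open>Normalized so that the cube bound becomes \<open>x powr (1 + a) * y powr (- a)\<close>,
  with \<open>x\<close> a lower bound for the \<open>g\<close>-mass of the cube and \<open>y\<close>
  its proportion of points, without further constants.\<close>

definition \<Phi> where "\<Phi> n A = real n powr a / J powr r * (LINT \<xi>:A|lborel. h n \<xi>)"
text \<open>The divisor is \<open>n\<close> rather than \<open>card (\<Gamma> n)\<close>, so the
  total mass is at most 1 and may be smaller.\<close>

definition \<mu> where "\<mu> n A = real (card (\<Gamma> n \<inter> A)) / real n"

lemma a_pos: "a > 0"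
  using r_pos by (simp add: a_def)

lemma J_pos: "J > 0"
  unfolding J_def using norm_N r_pos by (rule zador_const_pos)

lemma \<Gamma>_props:
  assumes "n \<ge> 1"
  shows "finite (\<Gamma> n)" "\<Gamma> n \<noteq> {}" "card (\<Gamma> n) \<le> n"
  using optimal assms by (auto simp: asymp_optimal_def)

lemma f_measurable [measurable]: "f \<in> borel_measurable borel"
  using f_cont by (rule borel_measurable_continuous_onI)

lemma g_pos: "g x > 0"
  using f_pos[of x] by (simp add: g_def)

lemma g_cont: "continuous_on UNIV g"
  unfolding g_def[abs_def]
proof (rule continuous_on_powr[OF f_cont continuous_on_const])
  show "\<forall>x\<in>UNIV. f x \<noteq> 0"
    using f_pos by (metis less_irrefl)
qed

lemma g_integrable: "integrable lborel g"
  using integrable_f_powr by (simp add: g_def[abs_def])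

lemma g_powr: "g x powr (1 + a) = f x"
proof -
  have "1 + a = (real CARD('d) + r) / real CARD('d)"
    by (simp add: a_def field_simps)
  moreover have "real CARD('d) + r > 0"
    using r_pos by (simp add: add_nonneg_pos)
  ultimately have eq: "real CARD('d) / (real CARD('d) + r) * (1 + a) = 1"
    by simp
  show ?thesis
    unfolding g_def powr_powr eq using f_pos[of x] by simp
qed

lemma I_pos: "I > 0"
proof -
  have "I \<ge> 0"
    unfolding I_def using g_pos by (intro integral_nonneg_AE) (auto intro: less_imp_le)
  moreover have "I \<noteq> 0"
  proof
    assume "I = 0"
    then have "AE x in lborel. g x = 0"
      unfolding I_def using g_integrable g_pos
      by (subst (asm) integral_nonneg_eq_0_iff_AE) (auto intro: less_imp_le)
    then have "AE x in (lborel :: (real ^ 'd) measure). False"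
      using g_pos by (auto simp: less_le)
    then show False
      using emeasure_lborel_UNIV[where 'a = "real ^ 'd"]
      by (auto simp: AE_iff_measurable[OF _ refl])
  qed
  ultimately show ?thesis by simp
qed

section \<open>Asymptotics of the error integrals\<close>

lemma h_nonneg:
  assumes "n \<ge> 1"
  shows "h n \<xi> \<ge> 0"
  unfolding h_def using f_pos[of \<xi>] min_dist_powr_nonneg[OF \<Gamma>_props(1,2)[OF assms]] by simp

text \<open>Asymptotic optimality raised to the power \<open>r\<close>; the exponent
  \<open>(d + r) / (d * r)\<close> of \<open>quant_coeff\<close> turns into
  \<open>1 + a\<close>.\<close>

lemma h_integral_tendsto:
  "(\<lambda>n. real n powr a * (\<integral>\<xi>. h n \<xi> \<partial>lborel)) \<longlonglongrightarrow> J powr r * I powr (1 + a)"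
proof -
  let ?d = "real CARD('d)"
  let ?P = "density lborel (\<lambda>x. ennreal (f x))"
  have "(\<lambda>n. (real n powr (1 / ?d) * quant_error N r (\<Gamma> n) ?P) powr r)
      \<longlonglongrightarrow> (J * I powr ((?d + r) / (?d * r))) powr r"
    using optimal J_pos I_pos r_pos unfolding asymp_optimal_def quant_coeff_def J_def I_def g_def
    by (intro tendsto_powr tendsto_const) auto
  also have "(J * I powr ((?d + r) / (?d * r))) powr r = J powr r * I powr (1 + a)"
  proof -
    have "(?d + r) / (?d * r) * r = 1 + a"
      using r_pos by (simp add: a_def field_simps)
    then show ?thesis
      using J_pos I_pos by (simp add: powr_mult powr_powr)
  qed
  finally show ?thesis
  proof (rule Lim_transform_eventually)
    show "\<forall>\<^sub>F n in sequentially. (real n powr (1 / ?d) * quant_error N r (\<Gamma> n) ?P) powr r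
        = real n powr a * (\<integral>\<xi>. h n \<xi> \<partial>lborel)"
      using eventually_ge_at_top[of "1 :: nat"]
    proof eventually_elim
      case (elim n)
      note \<Gamma> = \<Gamma>_props(1,2)[OF elim]
      have "(\<integral>\<xi>. min_dist_powr N r (\<Gamma> n) \<xi> \<partial>?P) = (\<integral>\<xi>. h n \<xi> \<partial>lborel)"
        unfolding h_def using f_pos borel_measurable_min_dist_powr[OF norm_N r_pos \<Gamma>]
        by (subst integral_density) (auto intro: less_imp_le)
      moreover have "(\<integral>\<xi>. h n \<xi> \<partial>lborel) \<ge> 0"
        using h_nonneg[OF elim] by (intro integral_nonneg_AE) auto
      ultimately show ?case
        using r_pos by (simp add: quant_error_eq_min_dist_powr powr_mult powr_powr a_def)
    qed
  qed
qed

text \<open>A non-integrable \<open>h n\<close> would have Bochner integral 0, whereas the rescaled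
  integrals have a positive limit.\<close>

lemma eventually_h_integrable: "\<forall>\<^sub>F n in sequentially. integrable lborel (h n)"
proof -
  have "J powr r * I powr (1 + a) > 0"
    using J_pos I_pos by simp
  from order_tendstoD(1)[OF h_integral_tendsto this] show ?thesis
    by eventually_elim (metis less_irrefl mult_zero_right not_integrable_integral_eq)
qed

lemma \<Phi>_UNIV_tendsto: "(\<lambda>n. \<Phi> n UNIV) \<longlonglongrightarrow> I powr (1 + a)"
  using tendsto_divide[OF h_integral_tendsto tendsto_const[of "J powr r"]] J_pos
  by (simp add: \<Phi>_def set_lebesgue_integral_def)

lemma h_integral_tendsto_0: "(\<lambda>n. \<integral>\<xi>. h n \<xi> \<partial>lborel) \<longlonglongrightarrow> 0"
proof -
  have "(\<lambda>n. real n powr (- a)) \<longlonglongrightarrow> 0"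
    using a_pos by (intro tendsto_neg_powr filterlim_real_sequentially) auto
  from tendsto_mult[OF this h_integral_tendsto]
  have "(\<lambda>n. real n powr (- a) * (real n powr a * (\<integral>\<xi>. h n \<xi> \<partial>lborel))) \<longlonglongrightarrow> 0"
    by simp
  then show ?thesis
  proof (rule Lim_transform_eventually)
    show "\<forall>\<^sub>F n in sequentially. real n powr (- a) * (real n powr a * (\<integral>\<xi>. h n \<xi> \<partial>lborel)) = (\<integral>\<xi>. h n \<xi> \<partial>lborel)"
      using eventually_gt_at_top[of 0] by eventually_elim (simp add: powr_minus)
  qed
qed

text \<open>A point of \<open>K\<close> at distance at least \<open>\<rho>\<close> from \<open>\<Gamma> n\<close> would keep the whole error integral
  away from \<open>0\<close>.\<close>

lemma eventually_dense_on_bounded: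
  assumes "bounded K" "\<rho> > 0"
  shows "\<forall>\<^sub>F n in sequentially. \<forall>\<xi>\<in>K. \<exists>x\<in>\<Gamma> n. N (\<xi> - x) < \<rho>"
proof -
  obtain C where C: "C > 0" "\<And>x. N x \<le> C * norm x"
    using is_norm_upper_bound[OF norm_N] by blast
  \<comment> \<open>A Euclidean displacement of at most \<open>\<eta>\<close> changes
    \<open>N\<close> by at most \<open>\<rho> / 2\<close>.\<close>
  define \<eta> where "\<eta> = \<rho> / (2 * C)"
  have \<eta>: "\<eta> > 0" "C * \<eta> = \<rho> / 2"
    using C \<open>\<rho> > 0\<close> by (auto simp: \<eta>_def)
  obtain R where R: "\<And>x. x \<in> K \<Longrightarrow> norm x \<le> R" "R > 0"
    using \<open>bounded K\<close> by (auto simp: bounded_pos)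
  have "cball 0 (R + \<eta>) \<noteq> ({} :: (real ^ 'd) set)"
    using R \<eta> by simp
  then obtain x0 where x0: "\<And>x. x \<in> cball 0 (R + \<eta>) \<Longrightarrow> f x0 \<le> f x"
    using continuous_attains_inf[OF compact_cball _ continuous_on_subset[OF f_cont subset_UNIV]] by metis
  define V where "V = measure lborel (cball (0 :: real ^ 'd) \<eta>)"
  have V: "measure lborel (cball \<xi> \<eta>) = V" for \<xi> :: "real ^ 'd"
    using content_cball[of \<eta> \<xi>] content_cball[of \<eta> "0 :: real ^ 'd"] \<eta> by (simp add: V_def)
  have V_pos: "V > 0"
    unfolding V_def using content_cball_pos[of \<eta>] \<eta> by blast
  \<comment> \<open>The error forced on the ball of radius \<open>\<eta>\<close> around a badly
    approximated point. It is uniform over \<open>K\<close>, since \<open>f x0\<close> is a minimum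
    over a ball containing all these balls.\<close>
  define m where "m = (\<rho> / 2) powr r * f x0 * V"
  have "m > 0"
    using \<open>\<rho> > 0\<close> f_pos V_pos by (simp add: m_def)
  show ?thesis
    using order_tendstoD(2)[OF h_integral_tendsto_0 \<open>m > 0\<close>] eventually_h_integrable
      eventually_ge_at_top[of 1]
  proof eventually_elim
    case (elim n)
    note \<Gamma> = \<Gamma>_props[OF elim(3)]
    show ?case
    proof (rule ccontr)
      assume "\<not> (\<forall>\<xi>\<in>K. \<exists>x\<in>\<Gamma> n. N (\<xi> - x) < \<rho>)"
      then obtain \<xi> where \<xi>: "\<xi> \<in> K" "\<And>x. x \<in> \<Gamma> n \<Longrightarrow> \<rho> \<le> N (\<xi> - x)"
        by force
      have far: "(\<rho> / 2) powr r * f x0 \<le> h n \<zeta>" if "\<zeta> \<in> cball \<xi> \<eta>" for \<zeta>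
      proof -
        have d: "norm (\<xi> - \<zeta>) \<le> \<eta>"
          using that by (simp add: dist_norm)
        have "(\<rho> / 2) powr r \<le> min_dist_powr N r (\<Gamma> n) \<zeta>"
        proof (rule min_dist_powr_ge[OF \<Gamma>(1,2)])
          fix x assume "x \<in> \<Gamma> n"
          have "N (\<xi> - \<zeta>) \<le> C * \<eta>"
            using C d by (meson mult_left_mono less_imp_le order_trans)
          moreover have "N (\<xi> - x) \<le> N (\<xi> - \<zeta>) + N (\<zeta> - x)"
            using is_norm_triangle[OF norm_N, of "\<xi> - \<zeta>" "\<zeta> - x"] by simp
          ultimately have "\<rho> / 2 \<le> N (\<zeta> - x)"
            using \<xi>(2)[OF \<open>x \<in> \<Gamma> n\<close>] \<eta>(2) by simp
          then show "(\<rho> / 2) powr r \<le> N (\<zeta> - x) powr r"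
            using r_pos \<open>\<rho> > 0\<close> by (intro powr_mono2) auto
        qed
        moreover have "f x0 \<le> f \<zeta>"
        proof (rule x0)
          have "norm \<zeta> \<le> norm \<xi> + norm (\<xi> - \<zeta>)"
            by (metis add.commute norm_minus_commute norm_triangle_sub)
          then show "\<zeta> \<in> cball 0 (R + \<eta>)"
            using R(1)[OF \<xi>(1)] d by simp
        qed
        ultimately show ?thesis
          unfolding h_def using f_pos[of \<zeta>] f_pos[of x0]
          by (subst mult.commute, intro mult_mono) auto
      qed
      have h_int: "set_integrable lborel UNIV (h n)"
        using elim(2) by (simp add: set_integrable_def)
      have "m = (LINT \<zeta>:cball \<xi> \<eta>|lborel. (\<rho> / 2) powr r * f x0)"
        by (simp add: m_def set_lebesgue_integral_def V)
      also have "\<dots> \<le> (LINT \<zeta>:cball \<xi> \<eta>|lborel. h n \<zeta>)"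
        using far by (intro set_integral_mono set_integrable_subset[OF h_int]
            set_integrable_continuous_compact compact_cball continuous_on_const) auto
      also have "\<dots> \<le> (LINT \<zeta>:UNIV|lborel. h n \<zeta>)"
        using h_nonneg[OF elim(3)] by (intro set_integral_mono_set[OF h_int]) auto
      also have "\<dots> = (\<integral>\<xi>. h n \<xi> \<partial>lborel)"
        by (simp add: set_lebesgue_integral_def)
      finally show False
        using elim(1) by simp
    qed
  qed
qed

text \<open>The cube is shrunk slightly, so that eventually all points of the smaller cube have their
  nearest quantizer point inside the original one.\<close>

lemma eventually_cube_lower_bound:
  fixes u :: "real ^ 'd"
  assumes "l > 0" "k > 0" "\<delta> > 0" "y > 0"
    and y: "\<And>x. x \<in> cbox u (u + l *\<^sub>R 1) \<Longrightarrow> y \<le> g x"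
  defines "Q \<equiv> box u (u + l *\<^sub>R 1)"
  shows "\<forall>\<^sub>F n in sequentially.
    (1 + a) * k powr (- a) * (y * l ^ CARD('d)) - \<delta> \<le> \<Phi> n Q + a * k powr (- a - 1) * \<mu> n Q"
proof -
  define A where "A = (1 + a) * k powr (- a)"
  \<comment> \<open>The bound depends continuously on the side length, so some side
    \<open>t < l\<close> loses less than \<open>\<delta>\<close>.\<close>
  have "((\<lambda>t. A * (y * t ^ CARD('d))) \<longlongrightarrow> A * (y * l ^ CARD('d))) (at_left l)"
    by (intro tendsto_intros)
  then have "\<forall>\<^sub>F t in at_left l. A * (y * l ^ CARD('d)) - \<delta> < A * (y * t ^ CARD('d))"
    using \<open>\<delta> > 0\<close> by (intro order_tendstoD(1)) auto
  moreover have "\<forall>\<^sub>F t in at_left l. t \<in> {0<..<l}"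
    using \<open>l > 0\<close> by (rule eventually_at_left_real)
  ultimately have "\<forall>\<^sub>F t in at_left l. A * (y * l ^ CARD('d)) - \<delta> < A * (y * t ^ CARD('d)) \<and> t \<in> {0<..<l}"
    by (rule eventually_conj)
  then obtain t where t: "A * (y * l ^ CARD('d)) - \<delta> < A * (y * t ^ CARD('d))" "0 < t" "t < l"
    using eventually_happens'[OF trivial_limit_at_left_real] by auto
  define s where "s = (l - t) / 2"
  have s: "s > 0" "l = t + 2 * s"
    using t by (auto simp: s_def field_simps)
  define K where "K = cbox (u + s *\<^sub>R 1) (u + s *\<^sub>R 1 + t *\<^sub>R 1)"
  have K_iff: "\<xi> \<in> K \<longleftrightarrow> (\<forall>i. u $ i + s \<le> \<xi> $ i \<and> \<xi> $ i \<le> u $ i + s + t)" for \<xi>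
    by (simp add: K_def mem_box_cart)
  have Q_iff: "\<xi> \<in> Q \<longleftrightarrow> (\<forall>i. u $ i < \<xi> $ i \<and> \<xi> $ i < u $ i + l)" for \<xi>
    by (simp add: Q_def mem_box_cart)
  have KQ: "K \<subseteq> Q"
  proof (intro subsetI, unfold K_iff Q_iff, intro allI)
    fix \<xi> i assume "\<forall>i. u $ i + s \<le> \<xi> $ i \<and> \<xi> $ i \<le> u $ i + s + t"
    from this[rule_format, of i] show "u $ i < \<xi> $ i \<and> \<xi> $ i < u $ i + l"
      using s by linarith
  qed
  have K_ne: "u + s *\<^sub>R 1 \<in> K"
    using t by (simp add: K_iff)
  have yK: "y \<le> g x" if "x \<in> K" for x
    using that KQ box_subset_cbox[of u "u + l *\<^sub>R 1"] by (intro y) (auto simp: Q_def)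
  obtain c where c: "c > 0" "\<And>x. c * norm x \<le> N x"
    using is_norm_lower_bound[OF norm_N] by blast
  have outside: "c * s \<le> N (\<xi> - x)" if "\<xi> \<in> K" "x \<notin> Q" for \<xi> x
  proof -
    obtain i where "\<not> (u $ i < x $ i \<and> x $ i < u $ i + l)"
      using \<open>x \<notin> Q\<close> by (auto simp: Q_iff)
    moreover have "u $ i + s \<le> \<xi> $ i" "\<xi> $ i \<le> u $ i + s + t"
      using \<open>\<xi> \<in> K\<close> by (auto simp: K_iff)
    ultimately have "s \<le> \<bar>(\<xi> - x) $ i\<bar>"
      using s by (auto simp: abs_if)
    then have "s \<le> norm (\<xi> - x)"
      using component_le_norm_cart order_trans by blast
    then show ?thesis
      using c by (meson mult_left_mono less_imp_le order_trans)
  qed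
  have "bounded K" "c * s > 0"
    using c s by (auto simp: K_def)
  from eventually_dense_on_bounded[OF this] eventually_h_integrable eventually_ge_at_top[of 1]
  show ?thesis
  proof eventually_elim
    case (elim n)
    note \<Gamma> = \<Gamma>_props[OF elim(3)]
    define m where "m = card (\<Gamma> n \<inter> Q)"
    have near: "\<exists>x\<in>\<Gamma> n \<inter> Q. N (\<xi> - x) < c * s" if "\<xi> \<in> K" for \<xi>
      using elim(1) outside that by (meson IntI not_le)
    have ne: "\<Gamma> n \<inter> Q \<noteq> {}" and fin: "finite (\<Gamma> n \<inter> Q)"
      using near[OF K_ne] \<Gamma>(1) by auto
    then have "m > 0"
      by (simp add: m_def card_gt_0_iff)
    \<comment> \<open>Points outside \<open>Q\<close> are at distance at least \<open>c * s\<close>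
      from \<open>K\<close>, while some point of \<open>\<Gamma> n\<close> inside \<open>Q\<close>
      is closer; hence a nearest point lies in \<open>Q\<close>, and discarding the others does not
      increase the distance.\<close>
    have D: "min_dist_powr N r (\<Gamma> n \<inter> Q) \<xi> \<le> min_dist_powr N r (\<Gamma> n) \<xi>" if "\<xi> \<in> K" for \<xi>
    proof -
      obtain x where x: "x \<in> \<Gamma> n" "min_dist_powr N r (\<Gamma> n) \<xi> = N (\<xi> - x) powr r"
        using min_dist_powr_attained[OF \<Gamma>(1,2)] by blast
      obtain x' where x': "x' \<in> \<Gamma> n \<inter> Q" "N (\<xi> - x') < c * s"
        using near[OF \<open>\<xi> \<in> K\<close>] by blast
      have "N (\<xi> - x) powr r \<le> N (\<xi> - x') powr r"
        using min_dist_powr_le[OF \<Gamma>(1), of x' N r \<xi>] x x' by simp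
      then have "N (\<xi> - x) \<le> N (\<xi> - x')"
        using r_pos is_norm_nonneg[OF norm_N] powr_less_mono2 not_le by metis
      then have "x \<in> Q"
        using outside[OF \<open>\<xi> \<in> K\<close>, of x] x'(2) by auto
      then show ?thesis
        using min_dist_powr_le[OF fin, of x] x by simp
    qed
    have h_int: "set_integrable lborel UNIV (h n)"
      using elim(2) by (simp add: set_integrable_def)
    note D_int = set_integrable_min_dist_powr_cbox[OF norm_N r_pos fin ne, of "u + s *\<^sub>R 1"
        "u + s *\<^sub>R 1 + t *\<^sub>R 1", folded K_def]
    have K_sets: "K \<in> sets lborel" and Q_sets: "Q \<in> sets lborel"
      by (simp_all add: K_def Q_def)
    have "y powr (1 + a) * (J powr r * real m powr (- a) * t powr (real CARD('d) + r))
        \<le> y powr (1 + a) * (LINT \<xi>:K|lborel. min_dist_powr N r (\<Gamma> n \<inter> Q) \<xi>)"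
      using cube_quantization_lower_bound[OF norm_N r_pos fin ne t(2), of "u + s *\<^sub>R 1"]
      unfolding J_def K_def m_def a_def by (intro mult_left_mono) auto
    also have "\<dots> = (LINT \<xi>:K|lborel. y powr (1 + a) * min_dist_powr N r (\<Gamma> n \<inter> Q) \<xi>)"
      by simp
    also have "\<dots> \<le> (LINT \<xi>:K|lborel. h n \<xi>)"
    proof (rule set_integral_mono)
      show "set_integrable lborel K (\<lambda>\<xi>. y powr (1 + a) * min_dist_powr N r (\<Gamma> n \<inter> Q) \<xi>)"
        using D_int by simp
      show "set_integrable lborel K (h n)"
        using K_sets by (intro set_integrable_subset[OF h_int]) auto
      fix \<xi> assume "\<xi> \<in> K"
      have "y powr (1 + a) \<le> g \<xi> powr (1 + a)"
        using yK[OF \<open>\<xi> \<in> K\<close>] \<open>y > 0\<close> a_pos by (intro powr_mono2) auto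
      then show "y powr (1 + a) * min_dist_powr N r (\<Gamma> n \<inter> Q) \<xi> \<le> h n \<xi>"
        unfolding h_def g_powr using D[OF \<open>\<xi> \<in> K\<close>] f_pos[of \<xi>] min_dist_powr_nonneg[OF fin ne]
        by (intro mult_mono) auto
    qed
    also have "\<dots> \<le> (LINT \<xi>:Q|lborel. h n \<xi>)"
      using K_sets Q_sets KQ h_nonneg[OF elim(3)]
      by (intro set_integral_mono_set set_integrable_subset[OF h_int]) auto
    finally have "real n powr a / J powr r *
        (y powr (1 + a) * (J powr r * real m powr (- a) * t powr (real CARD('d) + r))) \<le> \<Phi> n Q"
      unfolding \<Phi>_def by (intro mult_left_mono) auto
    moreover have "real n powr a / J powr r *
        (y powr (1 + a) * (J powr r * real m powr (- a) * t powr (real CARD('d) + r)))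
        = (y * t ^ CARD('d)) powr (1 + a) * (real m / real n) powr (- a)"
    proof -
      have "t powr (real CARD('d) + r) = (t ^ CARD('d)) powr (1 + a)"
        using t(2) by (simp add: powr_realpow[symmetric] powr_powr a_def algebra_simps)
      then show ?thesis
        using \<open>y > 0\<close> t(2) \<open>m > 0\<close> elim(3) J_pos
        by (simp add: powr_mult powr_divide powr_minus field_simps)
    qed
    \<comment> \<open>The tangent inequality for the mass bound \<open>y * t ^ d\<close> of the
      small cube and the proportion \<open>m / n\<close> of points in \<open>Q\<close>.\<close>
    moreover have "A * (y * t ^ CARD('d)) - a * k powr (- a - 1) * (real m / real n)
        \<le> (y * t ^ CARD('d)) powr (1 + a) * (real m / real n) powr (- a)"
      unfolding A_def using \<open>y > 0\<close> t(2) \<open>m > 0\<close> elim(3) a_pos \<open>k > 0\<close>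
      by (intro powr_tangent_bound) auto
    ultimately show ?case
      using t(1) by (simp add: A_def \<mu>_def m_def)
  qed
qed

text \<open>The affine cube bounds are summed over a lower-sum family for \<open>B\<close>. Using
  interiors makes the cells disjoint, so neither error nor points are counted twice. Half of
  \<open>\<delta>\<close> pays for the lower sum, the other half is shared among the cubes.\<close>

lemma eventually_open_lower_bound:
  assumes "open B" "k > 0" "\<delta> > 0"
  shows "\<forall>\<^sub>F n in sequentially.
    (1 + a) * k powr (- a) * (LINT x:B|lborel. g x) - \<delta> \<le> \<Phi> n B + a * k powr (- a - 1) * \<mu> n B"
proof -
  define A where "A = (1 + a) * k powr (- a)"
  have A: "A > 0"
    using a_pos \<open>k > 0\<close> by (simp add: A_def)
  have "\<delta> / (2 * A) > 0"
    using A \<open>\<delta> > 0\<close> by simp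
  from open_set_integral_lower_sum[OF g_cont g_pos g_integrable \<open>open B\<close> this]
  obtain \<F> where \<F>: "finite \<F>"
    "\<And>K. K \<in> \<F> \<Longrightarrow> \<exists>u l. 0 < l \<and> K = cbox u (u + l *\<^sub>R 1)"
    "pairwise (\<lambda>K L. interior K \<inter> interior L = {}) \<F>"
    "\<And>K. K \<in> \<F> \<Longrightarrow> K \<subseteq> B"
    "(LINT x:B|lborel. g x) - \<delta> / (2 * A) \<le> (\<Sum>K\<in>\<F>. Inf (g ` K) * measure lborel K)"
    by blast
  \<comment> \<open>The \<open>+ 1\<close> covers an empty family.\<close>
  define \<delta>' where "\<delta>' = \<delta> / (2 * (real (card \<F>) + 1))"
  have \<delta>': "\<delta>' > 0" "real (card \<F>) * \<delta>' \<le> \<delta> / 2"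
    using \<open>\<delta> > 0\<close> by (auto simp: \<delta>'_def field_simps)
  have "\<forall>\<^sub>F n in sequentially. A * (Inf (g ` K) * measure lborel K) - \<delta>'
      \<le> \<Phi> n (interior K) + a * k powr (- a - 1) * \<mu> n (interior K)" if "K \<in> \<F>" for K
  proof -
    obtain u l where K: "0 < l" "K = cbox u (u + l *\<^sub>R 1)"
      using \<F>(2) \<open>K \<in> \<F>\<close> by blast
    have K_ne: "K \<noteq> {}"
      using K by (auto simp: interval_ne_empty_cart)
    obtain x where x: "x \<in> K" "\<And>z. z \<in> K \<Longrightarrow> g x \<le> g z"
      using continuous_attains_inf[OF _ K_ne continuous_on_subset[OF g_cont subset_UNIV]] K(2)
      by (metis compact_cbox)
    have "Inf (g ` K) = g x"
      using x by (intro cInf_eq_minimum) auto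
    then show ?thesis
      using eventually_cube_lower_bound[OF K(1) \<open>k > 0\<close> \<delta>'(1) g_pos, of u x] x(2) K
        content_cube[of l u] by (simp add: A_def interior_cbox)
  qed
  then have "\<forall>\<^sub>F n in sequentially. \<forall>K\<in>\<F>. A * (Inf (g ` K) * measure lborel K) - \<delta>'
      \<le> \<Phi> n (interior K) + a * k powr (- a - 1) * \<mu> n (interior K)"
    using \<F>(1) by (simp add: eventually_ball_finite)
  with eventually_h_integrable eventually_ge_at_top[of 1] show ?thesis
  proof eventually_elim
    case (elim n)
    have h_int: "set_integrable lborel UNIV (h n)"
      using elim(1) by (simp add: set_integrable_def)
    have sub: "(\<Union>K\<in>\<F>. interior K) \<subseteq> B"
      using \<F>(4) interior_subset by blast
    have disj: "interior K \<inter> interior L = {}" if "K \<in> \<F>" "L \<in> \<F>" "K \<noteq> L" for K L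
      using \<F>(3) that by (auto simp: pairwise_def)
    have "(\<Sum>K\<in>\<F>. LINT \<xi>:interior K|lborel. h n \<xi>) = (LINT \<xi>:(\<Union>K\<in>\<F>. interior K)|lborel. h n \<xi>)"
      using disj by (intro set_integral_finite_UN_AE[symmetric] set_integrable_subset[OF h_int] \<F>(1) AE_I2) auto
    also have "\<dots> \<le> (LINT \<xi>:B|lborel. h n \<xi>)"
      using sub \<open>open B\<close> h_nonneg[OF elim(2)] open_UN[of \<F> interior]
      by (intro set_integral_mono_set set_integrable_subset[OF h_int]) auto
    finally have \<Phi>: "(\<Sum>K\<in>\<F>. \<Phi> n (interior K)) \<le> \<Phi> n B"
      unfolding \<Phi>_def sum_distrib_left[symmetric] by (intro mult_left_mono) auto
    have "(\<Sum>K\<in>\<F>. card (\<Gamma> n \<inter> interior K)) = card (\<Union>K\<in>\<F>. \<Gamma> n \<inter> interior K)"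
      using \<F>(1) disj \<Gamma>_props(1)[OF elim(2)] by (intro card_UN_disjoint[symmetric]) auto
    also have "\<dots> \<le> card (\<Gamma> n \<inter> B)"
      using sub \<Gamma>_props(1)[OF elim(2)] by (intro card_mono) auto
    finally have "(\<Sum>K\<in>\<F>. \<mu> n (interior K)) \<le> \<mu> n B"
      unfolding \<mu>_def sum_divide_distrib[symmetric] of_nat_sum[symmetric]
      by (intro divide_right_mono of_nat_mono) auto
    then have \<mu>: "a * k powr (- a - 1) * (\<Sum>K\<in>\<F>. \<mu> n (interior K)) \<le> a * k powr (- a - 1) * \<mu> n B"
      using a_pos by (intro mult_left_mono) auto
    have "A * ((LINT x:B|lborel. g x) - \<delta> / (2 * A)) \<le> A * (\<Sum>K\<in>\<F>. Inf (g ` K) * measure lborel K)"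
      using A \<F>(5) by (intro mult_left_mono) auto
    then have "A * (LINT x:B|lborel. g x) - \<delta> \<le> (\<Sum>K\<in>\<F>. A * (Inf (g ` K) * measure lborel K)) - \<delta> / 2"
      using A by (simp add: sum_distrib_left right_diff_distrib)
    also have "\<dots> \<le> (\<Sum>K\<in>\<F>. A * (Inf (g ` K) * measure lborel K) - \<delta>')"
      using \<delta>'(2) by (simp add: sum_subtractf)
    also have "\<dots> \<le> (\<Sum>K\<in>\<F>. \<Phi> n (interior K) + a * k powr (- a - 1) * \<mu> n (interior K))"
      using elim(3) by (intro sum_mono) auto
    also have "\<dots> \<le> \<Phi> n B + a * k powr (- a - 1) * \<mu> n B"
      using \<Phi> \<mu> by (simp add: sum.distrib sum_distrib_left)
    finally show ?case
      by (simp add: A_def)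
  qed
qed

end

section \<open>The empirical measure theorem\<close>

text \<open>The faces are null sets. This reconciles lower bounds for open sets with the closed
  boxes of the theorem.\<close>

lemma set_integral_box_eq_cbox:
  fixes h :: "'a :: euclidean_space \<Rightarrow> real"
  assumes [measurable]: "h \<in> borel_measurable borel"
  shows "(LINT x:box p q|lborel. h x) = (LINT x:cbox p q|lborel. h x)"
proof -
  have "cbox p q - box p q \<in> null_sets lborel"
    using negligible_frontier_interval[of p q]
    by (simp add: negligible_iff_null_sets null_sets_completion_iff)
  then have "AE x in lborel. x \<notin> cbox p q - box p q"
    by (rule AE_not_in)
  then show ?thesis
    using box_subset_cbox[of p q] unfolding set_lebesgue_integral_def
    by (intro integral_cong_AE) (auto elim!: eventually_mono simp: indicator_def)
qed

context asymp_optimal_quantizers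
begin

text \<open>The tangent parameters are \<open>1 / I\<close>, the optimal one, off the box and \<open>t / I\<close> on it;
  letting \<open>t\<close> tend to \<open>1\<close> from either side bounds the mass of the box from both sides.\<close>

lemma \<mu>_cbox_tendsto: "(\<lambda>n. \<mu> n (cbox p q)) \<longlonglongrightarrow> (LINT x:cbox p q|lborel. g x) / I"
proof (rule tendsto_from_tangent_bounds[OF a_pos])
  fix t \<delta> :: real assume "t > 0" "\<delta> > 0"
  define X where "X = I powr (1 + a)"
  define w where "w = (LINT x:cbox p q|lborel. g x) / I"
  let ?B = "cbox p q" and ?U = "box p q"
  have X: "X > 0"
    using I_pos by (simp add: X_def)
  have [measurable]: "g \<in> borel_measurable borel"
    using g_cont by (rule borel_measurable_continuous_onI)
  have gU: "(LINT x:?U|lborel. g x) = w * I"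
    using I_pos by (simp add: w_def set_integral_box_eq_cbox)
  have "(LINT x:- ?B|lborel. g x) = (\<integral>x. g x - indicator ?B x *\<^sub>R g x \<partial>lborel)"
    unfolding set_lebesgue_integral_def by (intro Bochner_Integration.integral_cong) (auto simp: indicator_def)
  also have "\<dots> = I - (LINT x:?B|lborel. g x)"
    unfolding set_lebesgue_integral_def I_def
    by (intro Bochner_Integration.integral_diff g_integrable integrable_mult_indicator) auto
  finally have gV: "(LINT x:- ?B|lborel. g x) = (1 - w) * I"
    using I_pos by (simp add: w_def left_diff_distrib)
  \<comment> \<open>For both tangent parameters all coefficients become multiples of
    \<open>X\<close>, the limit of \<open>\<Phi> n UNIV\<close>.\<close>
  have pow: "(t / I) powr (- a) * I = t powr (- a) * X" "(t / I) powr (- a - 1) = t powr (- a - 1) * X"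
    "(1 / I) powr (- a) * I = X" "(1 / I) powr (- a - 1) = X"
    using I_pos \<open>t > 0\<close> by (simp_all add: X_def powr_divide powr_minus powr_diff powr_add field_simps)
  \<comment> \<open>One third for each of the two lower bounds and the upper bound on the total; the
    factor \<open>X\<close> is cancelled at the end.\<close>
  define \<epsilon> where "\<epsilon> = X * \<delta> / 3"
  have \<epsilon>: "\<epsilon> > 0"
    using X \<open>\<delta> > 0\<close> by (simp add: \<epsilon>_def)
  have "t / I > 0" "1 / I > 0" "open ?U" "open (- ?B)"
    using \<open>t > 0\<close> I_pos closed_cbox by (auto simp: open_closed)
  note lowU = eventually_open_lower_bound[OF \<open>open ?U\<close> \<open>t / I > 0\<close> \<epsilon>]
    and lowV = eventually_open_lower_bound[OF \<open>open (- ?B)\<close> \<open>1 / I > 0\<close> \<epsilon>]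
  have "X < X + \<epsilon>"
    using \<epsilon> by simp
  note up = order_tendstoD(2)[OF \<Phi>_UNIV_tendsto this[unfolded X_def], folded X_def]
  show "\<forall>\<^sub>F n in sequentially. (1 + a) * (t powr (- a) - 1) * ((LINT x:?B|lborel. g x) / I) - \<delta>
      \<le> a * (t powr (- a - 1) - 1) * \<mu> n ?B"
    using lowU lowV up eventually_h_integrable eventually_ge_at_top[of 1]
  proof eventually_elim
    case (elim n)
    note \<Gamma> = \<Gamma>_props[OF elim(5)]
    define u where "u = \<mu> n ?B"
    have h_int: "set_integrable lborel UNIV (h n)"
      using elim(4) by (simp add: set_integrable_def)
    have "(LINT \<xi>:?U|lborel. h n \<xi>) + (LINT \<xi>:- ?B|lborel. h n \<xi>) = (LINT \<xi>:?U \<union> - ?B|lborel. h n \<xi>)"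
      using box_subset_cbox[of p q]
      by (intro set_integral_Un[symmetric] set_integrable_subset[OF h_int]) auto
    also have "\<dots> \<le> (LINT \<xi>:UNIV|lborel. h n \<xi>)"
      using h_nonneg[OF elim(5)] by (intro set_integral_mono_set h_int) auto
    finally have \<Phi>: "\<Phi> n ?U + \<Phi> n (- ?B) \<le> \<Phi> n UNIV"
      unfolding \<Phi>_def distrib_left[symmetric] by (intro mult_left_mono) auto
    \<comment> \<open>Points on the boundary of the box may be added here, since
      \<open>\<mu>\<close> enters the lower bound with a nonnegative coefficient.\<close>
    have \<mu>U: "\<mu> n ?U \<le> u"
      unfolding \<mu>_def u_def using \<Gamma>(1) box_subset_cbox[of p q]
      by (intro divide_right_mono of_nat_mono card_mono) auto
    have "card (\<Gamma> n \<inter> ?B) + card (\<Gamma> n \<inter> - ?B) = card (\<Gamma> n)"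
      using \<Gamma>(1) by (subst card_Un_disjoint[symmetric]) (auto intro: arg_cong[of _ _ card])
    then have "real (card (\<Gamma> n \<inter> ?B)) + real (card (\<Gamma> n \<inter> - ?B)) \<le> real n"
      using \<Gamma>(3) by linarith
    then have \<mu>V: "\<mu> n (- ?B) \<le> 1 - u"
      using elim(5) by (simp add: \<mu>_def u_def field_simps)
    have lowU': "(1 + a) * (t powr (- a) * X) * w - \<epsilon> \<le> \<Phi> n ?U + a * (t powr (- a - 1) * X) * u"
    proof -
      have "a * (t powr (- a - 1) * X) * \<mu> n ?U \<le> a * (t powr (- a - 1) * X) * u"
        using a_pos X \<mu>U by (intro mult_left_mono) auto
      then show ?thesis
        using elim(1) unfolding gU pow(2) pow(1)[symmetric] by (simp add: mult_ac)
    qed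
    have lowV': "(1 + a) * X * (1 - w) - \<epsilon> \<le> \<Phi> n (- ?B) + a * X * (1 - u)"
    proof -
      have "a * X * \<mu> n (- ?B) \<le> a * X * (1 - u)"
        using a_pos X \<mu>V by (intro mult_left_mono) auto
      moreover have "(1 + a) * (1 / I) powr (- a) * ((1 - w) * I) = (1 + a) * X * (1 - w)"
        unfolding pow(3)[symmetric] by (simp add: mult_ac)
      ultimately show ?thesis
        using elim(2) unfolding gV pow(4) by linarith
    qed
    \<comment> \<open>On adding the bounds, the terms free of \<open>w\<close>, \<open>u\<close> and
      the errors cancel: \<open>(1 + a) * X\<close> on the left against \<open>X + a * X\<close> on
      the right.\<close>
    have "X * ((1 + a) * (t powr (- a) - 1) * w - \<delta>) \<le> X * (a * (t powr (- a - 1) - 1) * u)"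
      using lowU' lowV' \<Phi> elim(3) by (simp add: \<epsilon>_def algebra_simps)
    then show ?case
      using X by (simp add: u_def w_def)
  qed
qed

lemma empirical_measure: "satisfies_empirical_measure_thm r f \<Gamma>"
  using \<mu>_cbox_tendsto by (simp add: satisfies_empirical_measure_thm_def \<mu>_def g_def I_def)

end

section \<open>Dilations and the exponential density\<close>

text \<open>Counting dilated points in a box amounts to counting the original points in the box
  shrunk by \<open>\<theta>\<close>. The substitution multiplies the integrals over the box and over
  the whole space by the same factor, which cancels in the quotient.\<close>

lemma satisfies_empirical_measure_thm_scale:
  fixes f :: "real ^ 'd \<Rightarrow> real"
  assumes emp: "satisfies_empirical_measure_thm r f \<Gamma>" and [measurable]: "f \<in> borel_measurable borel"
    and "\<theta> > 0" "k \<noteq> 0"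
    and f: "\<And>x. f (\<theta> *\<^sub>R x) powr (real CARD('d) / (real CARD('d) + s))
      = k * f x powr (real CARD('d) / (real CARD('d) + r))"
  shows "satisfies_empirical_measure_thm s f (\<lambda>n. (\<lambda>x. \<theta> *\<^sub>R x) ` \<Gamma> n)"
  unfolding satisfies_empirical_measure_thm_def
proof (intro allI)
  fix p q :: "real ^ 'd"
  let ?gr = "\<lambda>x. f x powr (real CARD('d) / (real CARD('d) + r))"
    and ?gs = "\<lambda>x. f x powr (real CARD('d) / (real CARD('d) + s))"
  define p' q' where "p' = (1 / \<theta>) *\<^sub>R p" and "q' = (1 / \<theta>) *\<^sub>R q"
  have mem: "\<theta> *\<^sub>R x \<in> cbox p q \<longleftrightarrow> x \<in> cbox p' q'" for x
    using \<open>\<theta> > 0\<close>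
    by (simp add: mem_box_cart p'_def q'_def pos_divide_le_eq pos_le_divide_eq mult.commute)
  have "(\<lambda>x. \<theta> *\<^sub>R x) ` \<Gamma> n \<inter> cbox p q = (\<lambda>x. \<theta> *\<^sub>R x) ` (\<Gamma> n \<inter> cbox p' q')" for n
    using mem by auto
  moreover have "inj_on (\<lambda>x :: real ^ 'd. \<theta> *\<^sub>R x) A" for A
    using \<open>\<theta> > 0\<close> by (auto simp: inj_on_def)
  ultimately have card: "card ((\<lambda>x. \<theta> *\<^sub>R x) ` \<Gamma> n \<inter> cbox p q) = card (\<Gamma> n \<inter> cbox p' q')" for n
    by (simp add: card_image)
  have total: "(\<integral>x. ?gs x \<partial>lborel) = (\<theta> ^ CARD('d) * k) * (\<integral>x. ?gr x \<partial>lborel)"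
    using \<open>\<theta> > 0\<close> by (subst lborel_integral_affine[where c = \<theta> and t = 0]) (simp_all add: f)
  have "indicator (cbox p q) (\<theta> *\<^sub>R x) = (indicator (cbox p' q') x :: real)" for x
    by (simp add: indicator_def mem)
  then have part: "(LINT x:cbox p q|lborel. ?gs x) = (\<theta> ^ CARD('d) * k) * (LINT x:cbox p' q'|lborel. ?gr x)"
    unfolding set_lebesgue_integral_def using \<open>\<theta> > 0\<close>
    by (subst lborel_integral_affine[where c = \<theta> and t = 0]) (simp_all add: f mult.left_commute)
  have "\<theta> ^ CARD('d) * k \<noteq> 0"
    using assms by simp
  then have "1 / (\<integral>x. ?gs x \<partial>lborel) * (LINT x:cbox p q|lborel. ?gs x)
      = 1 / (\<integral>x. ?gr x \<partial>lborel) * (LINT x:cbox p' q'|lborel. ?gr x)"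
    unfolding total part by simp
  moreover have "(\<lambda>n. 1 / real n * real (card (\<Gamma> n \<inter> cbox p' q')))
      \<longlonglongrightarrow> 1 / (\<integral>x. ?gr x \<partial>lborel) * (LINT x:cbox p' q'|lborel. ?gr x)"
    using emp unfolding satisfies_empirical_measure_thm_def by blast
  ultimately show "(\<lambda>n. 1 / real n * real (card ((\<lambda>x. \<theta> *\<^sub>R x) ` \<Gamma> n \<inter> cbox p q)))
      \<longlonglongrightarrow> 1 / (\<integral>x. ?gs x \<partial>lborel) * (LINT x:cbox p q|lborel. ?gs x)"
    unfolding card by (simp only:)
qed

theorem proposition5p4:
  fixes N :: "real ^ 'd \<Rightarrow> real"
    and r s \<alpha> lam c \<theta> :: real
    and f :: "real ^ 'd \<Rightarrow> real"
    and \<Gamma> :: "nat \<Rightarrow> (real ^ 'd) set"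
  assumes "is_norm N"
    and "r > 0" "s > 0" "\<alpha> > 0" "lam > 0" "c > 0"
    and "f = (\<lambda>x. c * exp (- lam * N x powr \<alpha>))"
    and "prob_space (density lborel (\<lambda>x. ennreal (f x)))"
    and "asymp_optimal N r f \<Gamma>"
    and "\<theta> = ((real CARD('d) + s) / (real CARD('d) + r)) powr (1 / \<alpha>)"
  shows "satisfies_empirical_measure_thm s f (\<lambda>n. (\<lambda>x. \<theta> *\<^sub>R x) ` \<Gamma> n)"
proof -
  define d where "d = real CARD('d)"
  have d: "d > 0"
    by (simp add: d_def)
  have f_pos: "f x > 0" for x
    using assms(6,7) by simp
  have f_cont: "continuous_on UNIV f"
    unfolding assms(7) using is_norm_continuous[OF assms(1)] is_norm_nonneg[OF assms(1)] assms(4)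
    by (intro continuous_intros continuous_on_powr') auto
  then have [measurable]: "f \<in> borel_measurable borel"
    by (rule borel_measurable_continuous_onI)
  have "(\<integral>\<^sup>+x. ennreal (f x) \<partial>lborel) = 1"
    using prob_space.emeasure_space_1[OF assms(8)] by (simp add: emeasure_density)
  then have f_int: "integrable lborel f"
    using f_pos by (intro integrableI_nonneg) (auto intro: less_imp_le)
  \<comment> \<open>A power of the exponential density is, up to a constant, a dilate of it:
    \<open>w\<close> is absorbed into the argument by homogeneity of \<open>N\<close>. Integrability
    of all positive powers follows from that of \<open>f\<close>.\<close>
  have scale: "f x powr w = c powr w / c * f (w powr (1 / \<alpha>) *\<^sub>R x)" if "w > 0" for w x
  proof -
    have "N (w powr (1 / \<alpha>) *\<^sub>R x) powr \<alpha> = w * N x powr \<alpha>"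
      using \<open>w > 0\<close> assms(4) by (simp add: is_norm_scale[OF assms(1)] is_norm_nonneg[OF assms(1)]
          powr_mult powr_powr)
    moreover have "exp y powr w = exp (w * y)" for y :: real
      by (simp add: powr_def)
    ultimately show ?thesis
      using assms(6) by (simp add: assms(7) powr_mult mult_ac)
  qed
  have f_powr_int: "integrable lborel (\<lambda>x. f x powr w)" if "w > 0" for w
    using lborel_integrable_affine_iff[of f "w powr (1 / \<alpha>)" 0] f_int that by (simp add: scale)
  have w: "d / (d + s) > 0" "d / (d + r) > 0"
    using d assms(2,3) by auto
  interpret asymp_optimal_quantizers N r f \<Gamma>
    using assms(1,2,9) f_cont f_pos f_powr_int[OF w(2)] by unfold_locales (auto simp: d_def)
  \<comment> \<open>This is where \<open>\<theta>\<close> comes from: it turns the dilation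
    belonging to the exponent \<open>d / (d + s)\<close> into that of
    \<open>d / (d + r)\<close>.\<close>
  have "(d / (d + s)) powr (1 / \<alpha>) * \<theta> = (d / (d + s) * ((d + s) / (d + r))) powr (1 / \<alpha>)"
    using w d assms(2,3) unfolding assms(10) d_def[symmetric] by (subst powr_mult) auto
  also have "d / (d + s) * ((d + s) / (d + r)) = d / (d + r)"
    using d assms(3) by simp
  finally have \<theta>: "(d / (d + s)) powr (1 / \<alpha>) * \<theta> = (d / (d + r)) powr (1 / \<alpha>)" .
  show ?thesis
  proof (rule satisfies_empirical_measure_thm_scale[OF empirical_measure])
    show "\<theta> > 0"
      using d assms(2,3) unfolding assms(10) d_def[symmetric] by simp
    show "f (\<theta> *\<^sub>R x) powr (real CARD('d) / (real CARD('d) + s))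
        = (c powr (d / (d + s)) / c powr (d / (d + r))) * f x powr (real CARD('d) / (real CARD('d) + r))" for x
      unfolding d_def[symmetric] scale[OF w(1)] scale[OF w(2)] scaleR_scaleR \<theta>
      using assms(6) by simp
    show "c powr (d / (d + s)) / c powr (d / (d + r)) \<noteq> 0"
      using assms(6) by simp
  qed measurable
qed

end
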